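(* Let $(M^{2m+1},H)$ be a contact manifold, regarded as a step 2 Carnot manifold with filtration $H\subset TM$, and let $\theta$ be a contact $1$-form near a point $a\in M$ with $\ker\theta=H$. Then all Darboux coordinates $(x_1,\ldots,x_{2m},t)$ centered at $a$, i.e. coordinates in which $$\theta=dt+\frac12\sum_{1\le j\le m}\left(x_{m+j}\,dx_j-x_j\,dx_{m+j}\right),$$ are Carnot coordinates at $a$ with respect to the $H$-frame $(X_1,\ldots,X_{2m},T)$ given by $$T=\partial_t,\qquad X_j=\partial_{x_j}-\tfrac12x_{m+j}\partial_t,\qquad X_{m+j}=\partial_{x_{m+j}}+\tfrac12x_j\partial_t,\qquad j=1,\ldots,m.$$
   Context: A Carnot manifold of step $r$ is a smooth manifold $M$ ($\dim M=n$) with a filtration by subbundles $H_1\subset\cdots\subset H_r=TM$ such that the Lie bracket of local sections of $H_w$ and $H_{w'}$ is a section of $H_{w+w'}$ whenever $w+w'\le r$. Its weights are $w_j=\min\{w:\ j\le \mathrm{rk}\,H_w\}$, $1\le j\le n$ (here $n=2m+1$ and the weights are $(1,\ldots,1,2)$, the last coordinate being $t$). An $H$-frame near $a$ is a tangent frame $(X_1,\ldots,X_n)$ near $a$ with each $X_j$ a section of $H_{w_j}$; then $[X_i,X_j]=\sum_{w_k\le w_i+w_j}L_{ij}^k X_k$ with smooth functions $L_{ij}^k$ near $a$. (In the claim the last element of the frame is denoted $T$.) Dilations on $\mathbb{R}^n$: $\delta_s(x)=s\cdot x=(s^{w_1}x_1,\ldots,s^{w_n}x_n)$. For a vector field $X=\sum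 a_j(x)\partial_j$, $\delta_s^*X=\sum_j s^{-w_j}a_j(s\cdot x)\partial_j$. Order and privileged coordinates: for $I=(i_1,\ldots,i_k)$, $k\ge 0$, put $X_I=X_{i_1}\cdots X_{i_k}$, $\langle I\rangle=w_{i_1}+\cdots+w_{i_k}$. A smooth $f$ near $a$ has order $N$ at $a$ if $X_If(a)=0$ whenever $\langle I\rangle<N$ and $X_If(a)\ne0$ for some $I$ with $\langle I\rangle=N$. Local coordinates centered at $a$ are linearly adapted to the $H$-frame if $X_j(0)=\partial_j$ for all $j$; they are privileged coordinates at $a$ adapted to the $H$-frame if moreover each $j$-th coordinate function has order $w_j$ at $a$. In privileged coordinates, $s^{w_j}\delta_s^*X_j$ converges as $s\to0$ ($C^\infty$ uniformly on compact sets) to a polynomial vector field $X_j^{(a)}$ on $\mathbb{R}^n$, the model vector field of $X_j$. The group $G(a)$: equip $\mathbb{R}^n$, with canonical basis $(\epsilon_j)$, with the nilpotent Lie bracket $[\epsilon_i,\epsilon_j]=\sum_{w_k=w_i+w_j}L_{ij}^k(a)\epsilon_k$ (zero if $w_i+w_j>r$). $G(a)$ is $\mathbb{R}^n$ with the Dynkin (Baker-Campbell-Hausdorff) product $x\cdot y=x+y+\frac12[x,y]+\frac1{12}([x,[x,y]]+[y,[y,x]])+\cdots$ (for $r=2$ just $x+y+\frac12[x,y]$). $X_j^a$ is the left-invariant vector field on $G(a)$ with $X_j^a(0)=\partial_j$. Carnot coordinates at $a$ with respect to (adapted to) an $H$-frame are privileged coordinates at $a$ adapted to it in which the model vector field of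 the $j$-th frame element is $X_j^a$ for every $j$. *)

theory Defs
  imports "HOL-Analysis.Analysis"
begin

section \<open>Smooth maps between normed spaces\<close>

text \<open>Only meant for open \<open>S\<close>.\<close>

fun Ck_on :: "nat \<Rightarrow> 'a::real_normed_vector set \<Rightarrow> ('a \<Rightarrow> 'b::real_normed_vector) \<Rightarrow> bool" where
  "Ck_on 0 S f \<longleftrightarrow> continuous_on S f"
| "Ck_on (Suc k) S f \<longleftrightarrow>
     (\<forall>x\<in>S. f differentiable (at x)) \<and> (\<forall>v. Ck_on k S (\<lambda>x. frechet_derivative f (at x) v))"

definition smooth_on :: "'a::real_normed_vector set \<Rightarrow> ('a \<Rightarrow> 'b::real_normed_vector) \<Rightarrow> bool" where
  "smooth_on S f \<longleftrightarrow> (\<forall>k. Ck_on k S f)"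


section \<open>Smooth manifolds\<close>

text \<open>The manifold is the whole of a Hausdorff, second countable type \<open>'a\<close>, and its dimension is
  \<open>CARD('n)\<close>. A chart is a pair of an open domain and a map that is only relevant on this domain.\<close>

type_synonym ('a, 'n) chart = "'a set \<times> ('a \<Rightarrow> real ^ 'n)"

abbreviation cdom :: "('a, 'n::finite) chart \<Rightarrow> 'a set" where "cdom \<equiv> fst"
abbreviation cmap :: "('a, 'n::finite) chart \<Rightarrow> 'a \<Rightarrow> real ^ 'n" where "cmap \<equiv> snd"

definition cinv :: "('a, 'n::finite) chart \<Rightarrow> real ^ 'n \<Rightarrow> 'a" where
  "cinv c = inv_into (cdom c) (cmap c)"

definition coord :: "('a, 'n::finite) chart \<Rightarrow> 'n \<Rightarrow> 'a \<Rightarrow> real" where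
  "coord c j = (\<lambda>p. cmap c p $ j)"

definition is_chart :: "('a::topological_space, 'n::finite) chart \<Rightarrow> bool" where
  "is_chart c \<longleftrightarrow> open (cdom c) \<and> open (cmap c ` cdom c) \<and>
     homeomorphism (cdom c) (cmap c ` cdom c) (cmap c) (cinv c)"

definition compatible :: "('a::topological_space, 'n::finite) chart \<Rightarrow> ('a, 'n) chart \<Rightarrow> bool" where
  "compatible c d \<longleftrightarrow>
     smooth_on (cmap c ` (cdom c \<inter> cdom d)) (cmap d \<circ> cinv c) \<and>
     smooth_on (cmap d ` (cdom c \<inter> cdom d)) (cmap c \<circ> cinv d)"

text \<open>A smooth structure is a maximal atlas, so that its elements are exactly the local coordinate
  systems of the manifold.\<close>

definition smooth_structure ::
    "('a::{t2_space,second_countable_topology}, 'n::finite) chart set \<Rightarrow> bool" where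
  "smooth_structure A \<longleftrightarrow>
     (\<forall>c\<in>A. is_chart c) \<and> (\<Union>c\<in>A. cdom c) = UNIV \<and>
     (\<forall>c\<in>A. \<forall>d\<in>A. compatible c d) \<and>
     (\<forall>c. is_chart c \<and> (\<forall>d\<in>A. compatible c d) \<longrightarrow> c \<in> A)"

definition smooth_fun ::
    "('a::topological_space, 'n::finite) chart set \<Rightarrow> 'a set \<Rightarrow> ('a \<Rightarrow> real) \<Rightarrow> bool" where
  "smooth_fun A U f \<longleftrightarrow> (\<forall>c\<in>A. smooth_on (cmap c ` (U \<inter> cdom c)) (f \<circ> cinv c))"

definition smooth_near ::
    "('a::topological_space, 'n::finite) chart set \<Rightarrow> 'a \<Rightarrow> ('a \<Rightarrow> real) \<Rightarrow> bool" where
  "smooth_near A p f \<longleftrightarrow> (\<exists>U. open U \<and> p \<in> U \<and> smooth_fun A U f)"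

text \<open>A tangent vector at \<open>p\<close> is a directional derivative acting on the functions that are smooth
  near \<open>p\<close>. It takes the dummy value 0 on all other functions, so that two tangent vectors are equal
  as soon as they agree on the functions smooth near \<open>p\<close>.\<close>

type_synonym 'a tvec = "('a \<Rightarrow> real) \<Rightarrow> real"
type_synonym 'a vfield = "'a \<Rightarrow> 'a tvec"

definition chart_vec ::
    "('a::topological_space, 'n::finite) chart set \<Rightarrow> ('a, 'n) chart \<Rightarrow> 'a \<Rightarrow> real ^ 'n \<Rightarrow> 'a tvec" where
  "chart_vec A c p u =
     (\<lambda>f. if smooth_near A p f then frechet_derivative (f \<circ> cinv c) (at (cmap c p)) u else 0)"

definition tangent_space ::
    "('a::topological_space, 'n::finite) chart set \<Rightarrow> 'a \<Rightarrow> 'a tvec set" where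
  "tangent_space A p = {chart_vec A c p u | c u. c \<in> A \<and> p \<in> cdom c}"

definition coord_vec ::
    "('a::topological_space, 'n::finite) chart set \<Rightarrow> ('a, 'n) chart \<Rightarrow> 'n \<Rightarrow> 'a vfield" where
  "coord_vec A c j = (\<lambda>p. chart_vec A c p (axis j 1))"

definition smooth_vfield ::
    "('a::topological_space, 'n::finite) chart set \<Rightarrow> 'a set \<Rightarrow> 'a vfield \<Rightarrow> bool" where
  "smooth_vfield A U X \<longleftrightarrow>
     (\<forall>p\<in>U. X p \<in> tangent_space A p) \<and>
     (\<forall>V f. open V \<and> smooth_fun A V f \<longrightarrow> smooth_fun A (U \<inter> V) (\<lambda>p. X p f))"

definition lie_bracket ::
    "('a::topological_space, 'n::finite) chart set \<Rightarrow> 'a vfield \<Rightarrow> 'a vfield \<Rightarrow> 'a vfield" where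
  "lie_bracket A X Y =
     (\<lambda>p f. if smooth_near A p f then X p (\<lambda>q. Y q f) - Y p (\<lambda>q. X q f) else 0)"

definition is_basis :: "'j set \<Rightarrow> ('j \<Rightarrow> 'a tvec) \<Rightarrow> 'a tvec set \<Rightarrow> bool" where
  "is_basis J B E \<longleftrightarrow>
     E = {(\<lambda>f. \<Sum>j\<in>J. c j * B j f) | c. True} \<and>
     (\<forall>c. (\<lambda>f. \<Sum>j\<in>J. c j * B j f) = (\<lambda>f. 0) \<longrightarrow> (\<forall>j\<in>J. c j = 0))"

definition subbundle ::
    "('a::topological_space, 'n::finite) chart set \<Rightarrow> ('a \<Rightarrow> 'a tvec set) \<Rightarrow> nat \<Rightarrow> bool" where
  "subbundle A E k \<longleftrightarrow>
     (\<forall>p. \<exists>U X. open U \<and> p \<in> U \<and> (\<forall>j<k. smooth_vfield A U (X j)) \<and>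
        (\<forall>q\<in>U. is_basis {..<k} (\<lambda>j. X j q) (E q)))"

definition is_section ::
    "('a::topological_space, 'n::finite) chart set \<Rightarrow> ('a \<Rightarrow> 'a tvec set) \<Rightarrow> 'a set \<Rightarrow> 'a vfield \<Rightarrow> bool" where
  "is_section A E U X \<longleftrightarrow> smooth_vfield A U X \<and> (\<forall>p\<in>U. X p \<in> E p)"


section \<open>Contact manifolds\<close>

definition one_form ::
    "('a::topological_space, 'n::finite) chart set \<Rightarrow> 'a set \<Rightarrow> ('a \<Rightarrow> 'a tvec \<Rightarrow> real) \<Rightarrow> bool" where
  "one_form A U \<theta> \<longleftrightarrow>
     (\<forall>p\<in>U. \<forall>u\<in>tangent_space A p. \<forall>v\<in>tangent_space A p. \<forall>\<alpha> \<beta>.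
        \<theta> p (\<lambda>f. \<alpha> * u f + \<beta> * v f) = \<alpha> * \<theta> p u + \<beta> * \<theta> p v) \<and>
     (\<forall>V X. open V \<and> smooth_vfield A V X \<longrightarrow> smooth_fun A (U \<inter> V) (\<lambda>p. \<theta> p (X p)))"

definition form_ker ::
    "('a::topological_space, 'n::finite) chart set \<Rightarrow> ('a \<Rightarrow> 'a tvec \<Rightarrow> real) \<Rightarrow> 'a \<Rightarrow> 'a tvec set" where
  "form_ker A \<theta> p = {v \<in> tangent_space A p. \<theta> p v = 0}"

text \<open>\<open>d\<theta>(X,Y) = X(\<theta>(Y)) - Y(\<theta>(X)) - \<theta>([X,Y])\<close>, whose value at \<open>p\<close> depends only on the values of
  the vector fields \<open>X\<close> and \<open>Y\<close> at \<open>p\<close>.\<close>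

definition ext_deriv ::
    "('a::topological_space, 'n::finite) chart set \<Rightarrow> ('a \<Rightarrow> 'a tvec \<Rightarrow> real) \<Rightarrow>
     'a vfield \<Rightarrow> 'a vfield \<Rightarrow> 'a \<Rightarrow> real" where
  "ext_deriv A \<theta> X Y p =
     X p (\<lambda>q. \<theta> q (Y q)) - Y p (\<lambda>q. \<theta> q (X q)) - \<theta> p (lie_bracket A X Y p)"

text \<open>The last clause says that \<open>d\<theta>\<close> is nondegenerate on \<open>ker \<theta>\<close>; vectors at \<open>p\<close> are represented
  by the values at \<open>p\<close> of smooth vector fields defined near \<open>p\<close>.\<close>

definition contact_form ::
    "('a::topological_space, 'n::finite) chart set \<Rightarrow> 'a set \<Rightarrow> ('a \<Rightarrow> 'a tvec \<Rightarrow> real) \<Rightarrow> bool" where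
  "contact_form A U \<theta> \<longleftrightarrow>
     one_form A U \<theta> \<and>
     (\<forall>p\<in>U. \<exists>v\<in>tangent_space A p. \<theta> p v \<noteq> 0) \<and>
     (\<forall>p\<in>U. \<forall>V X. open V \<and> p \<in> V \<and> smooth_vfield A V X \<and> X p \<in> form_ker A \<theta> p \<and>
        (\<forall>W Y. open W \<and> p \<in> W \<and> smooth_vfield A W Y \<and> Y p \<in> form_ker A \<theta> p \<longrightarrow>
           ext_deriv A \<theta> X Y p = 0)
        \<longrightarrow> X p = (\<lambda>f. 0))"

text \<open>The indices \<open>1, \<dots>, 2m+1\<close> with \<open>m = CARD('m)\<close>: for \<open>j :: 'm\<close>, the index \<open>j\<close> is \<open>ix j\<close>, the
  index \<open>m + j\<close> is \<open>iy j\<close>, and the last index (that of \<open>t\<close>) is \<open>it\<close>.\<close>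

type_synonym 'm cindex = "('m + 'm) + unit"

abbreviation ix :: "'m \<Rightarrow> 'm cindex" where "ix j \<equiv> Inl (Inl j)"
abbreviation iy :: "'m \<Rightarrow> 'm cindex" where "iy j \<equiv> Inl (Inr j)"
abbreviation it :: "'m cindex" where "it \<equiv> Inr ()"

definition contact_manifold ::
    "('a::{t2_space,second_countable_topology}, 'm::finite cindex) chart set \<Rightarrow>
     ('a \<Rightarrow> 'a tvec set) \<Rightarrow> bool" where
  "contact_manifold A H \<longleftrightarrow>
     smooth_structure A \<and> subbundle A H (2 * CARD('m)) \<and>
     (\<forall>p. \<exists>U \<theta>. open U \<and> p \<in> U \<and> contact_form A U \<theta> \<and> (\<forall>q\<in>U. H q = form_ker A \<theta> q))"

text \<open>Charts centered at \<open>a\<close> in which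
  \<open>\<theta> = dt + 1/2 \<Sum>\<^sub>j (x\<^sub>m\<^sub>+\<^sub>j dx\<^sub>j - x\<^sub>j dx\<^sub>m\<^sub>+\<^sub>j)\<close>; note that \<open>dx\<^sub>i(v) = v(x\<^sub>i)\<close>.\<close>

definition darboux_coords ::
    "('a::topological_space, 'm::finite cindex) chart set \<Rightarrow> 'a set \<Rightarrow> ('a \<Rightarrow> 'a tvec \<Rightarrow> real) \<Rightarrow>
     'a \<Rightarrow> ('a, 'm cindex) chart \<Rightarrow> bool" where
  "darboux_coords A U \<theta> a c \<longleftrightarrow>
     c \<in> A \<and> a \<in> cdom c \<and> cdom c \<subseteq> U \<and> cmap c a = 0 \<and>
     (\<forall>p\<in>cdom c. \<forall>v\<in>tangent_space A p.
        \<theta> p v = v (coord c it) + 1/2 * (\<Sum>j\<in>UNIV. coord c (iy j) p * v (coord c (ix j))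
                                                - coord c (ix j) p * v (coord c (iy j))))"

fun darboux_frame ::
    "('a::topological_space, 'm::finite cindex) chart set \<Rightarrow> ('a, 'm cindex) chart \<Rightarrow>
     'm cindex \<Rightarrow> 'a vfield" where
  "darboux_frame A c (Inl (Inl j)) =
     (\<lambda>p f. coord_vec A c (ix j) p f - 1/2 * coord c (iy j) p * coord_vec A c it p f)"
| "darboux_frame A c (Inl (Inr j)) =
     (\<lambda>p f. coord_vec A c (iy j) p f + 1/2 * coord c (ix j) p * coord_vec A c it p f)"
| "darboux_frame A c (Inr _) = coord_vec A c it"


section \<open>Carnot manifolds\<close>

text \<open>The index type \<open>'n\<close> is not ordered, so the relation between the weights and the
  filtration, \<open>w\<^sub>j = min {v. j \<le> rk H\<^sub>v}\<close>, is expressed by \<open>rk H\<^sub>v = card {j. w\<^sub>j \<le> v}\<close>.\<close>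

definition carnot_manifold ::
    "('a::{t2_space,second_countable_topology}, 'n::finite) chart set \<Rightarrow> nat \<Rightarrow>
     (nat \<Rightarrow> 'a \<Rightarrow> 'a tvec set) \<Rightarrow> ('n \<Rightarrow> nat) \<Rightarrow> bool" where
  "carnot_manifold A r H w \<longleftrightarrow>
     smooth_structure A \<and> (\<forall>j. 1 \<le> w j \<and> w j \<le> r) \<and>
     (\<forall>v\<in>{1..r}. subbundle A (H v) (card {j. w j \<le> v})) \<and>
     (\<forall>v\<in>{1..<r}. \<forall>p. H v p \<subseteq> H (Suc v) p) \<and>
     (\<forall>p. H r p = tangent_space A p) \<and>
     (\<forall>v v' U X Y. 1 \<le> v \<and> 1 \<le> v' \<and> v + v' \<le> r \<and> open U \<and>
        is_section A (H v) U X \<and> is_section A (H v') U Y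
        \<longrightarrow> is_section A (H (v + v')) U (lie_bracket A X Y))"

definition H_frame_near ::
    "('a::topological_space, 'n::finite) chart set \<Rightarrow> (nat \<Rightarrow> 'a \<Rightarrow> 'a tvec set) \<Rightarrow> ('n \<Rightarrow> nat) \<Rightarrow>
     'a \<Rightarrow> ('n \<Rightarrow> 'a vfield) \<Rightarrow> bool" where
  "H_frame_near A H w a X \<longleftrightarrow>
     (\<exists>U. open U \<and> a \<in> U \<and> (\<forall>j. is_section A (H (w j)) U (X j)) \<and>
        (\<forall>p\<in>U. is_basis UNIV (\<lambda>j. X j p) (tangent_space A p)))"

definition contact_filtration ::
    "('a::topological_space, 'n::finite) chart set \<Rightarrow> ('a \<Rightarrow> 'a tvec set) \<Rightarrow> nat \<Rightarrow> 'a \<Rightarrow> 'a tvec set" where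
  "contact_filtration A H v = (if v \<le> 1 then H else tangent_space A)"

fun contact_weight :: "'m cindex \<Rightarrow> nat" where
  "contact_weight (Inl _) = 1"
| "contact_weight (Inr _) = 2"


subsection \<open>Order of functions and privileged coordinates\<close>

text \<open>\<open>X\<^sub>I f\<close>; the last vector field of the word \<open>I\<close> is applied first.\<close>

fun iter_vfield :: "('n \<Rightarrow> 'a vfield) \<Rightarrow> 'n list \<Rightarrow> ('a \<Rightarrow> real) \<Rightarrow> 'a \<Rightarrow> real" where
  "iter_vfield X [] f = f"
| "iter_vfield X (i # I) f = (\<lambda>p. X i p (iter_vfield X I f))"

definition has_order ::
    "('a::topological_space, 'n::finite) chart set \<Rightarrow> ('n \<Rightarrow> nat) \<Rightarrow> ('n \<Rightarrow> 'a vfield) \<Rightarrow> 'a \<Rightarrow>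
     ('a \<Rightarrow> real) \<Rightarrow> nat \<Rightarrow> bool" where
  "has_order A w X a f N \<longleftrightarrow>
     smooth_near A a f \<and>
     (\<forall>I. sum_list (map w I) < N \<longrightarrow> iter_vfield X I f a = 0) \<and>
     (\<exists>I. sum_list (map w I) = N \<and> iter_vfield X I f a \<noteq> 0)"

definition linearly_adapted ::
    "('a::topological_space, 'n::finite) chart set \<Rightarrow> ('n \<Rightarrow> 'a vfield) \<Rightarrow> 'a \<Rightarrow> ('a, 'n) chart \<Rightarrow> bool" where
  "linearly_adapted A X a c \<longleftrightarrow>
     c \<in> A \<and> a \<in> cdom c \<and> cmap c a = 0 \<and> (\<forall>j. X j a = coord_vec A c j a)"

definition privileged_coords ::
    "('a::topological_space, 'n::finite) chart set \<Rightarrow> ('n \<Rightarrow> nat) \<Rightarrow> ('n \<Rightarrow> 'a vfield) \<Rightarrow> 'a \<Rightarrow>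
     ('a, 'n) chart \<Rightarrow> bool" where
  "privileged_coords A w X a c \<longleftrightarrow>
     linearly_adapted A X a c \<and> (\<forall>j. has_order A w X a (coord c j) (w j))"


subsection \<open>Model vector fields\<close>

definition dilation :: "('n::finite \<Rightarrow> nat) \<Rightarrow> real \<Rightarrow> real ^ 'n \<Rightarrow> real ^ 'n" where
  "dilation w s x = (\<chi> j. s ^ w j * x $ j)"

definition dilation_pullback ::
    "('n::finite \<Rightarrow> nat) \<Rightarrow> real \<Rightarrow> (real ^ 'n \<Rightarrow> real ^ 'n) \<Rightarrow> real ^ 'n \<Rightarrow> real ^ 'n" where
  "dilation_pullback w s Y x = (\<chi> j. Y (dilation w s x) $ j / s ^ w j)"

text \<open>The components \<open>X(x\<^sub>k)\<close> of a vector field in a chart. They are meaningful only on the image of the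
  chart domain; this is harmless in limits as \<open>s \<rightarrow> 0\<close>, since the dilation by a small \<open>s\<close> maps a given
  compact set into any given neighbourhood of 0.\<close>

definition chart_rep :: "('a, 'n::finite) chart \<Rightarrow> 'a vfield \<Rightarrow> real ^ 'n \<Rightarrow> real ^ 'n" where
  "chart_rep c X x = (\<chi> k. X (cinv c x) (coord c k))"

fun iter_partial ::
    "'n list \<Rightarrow> (real ^ 'n::finite \<Rightarrow> real ^ 'n) \<Rightarrow> real ^ 'n \<Rightarrow> real ^ 'n" where
  "iter_partial [] f = f"
| "iter_partial (j # J) f = (\<lambda>x. frechet_derivative (iter_partial J f) (at x) (axis j 1))"

definition smooth_limit ::
    "(real \<Rightarrow> real ^ 'n::finite \<Rightarrow> real ^ 'n) \<Rightarrow> (real ^ 'n \<Rightarrow> real ^ 'n) \<Rightarrow> real filter \<Rightarrow> bool" where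
  "smooth_limit F Y flt \<longleftrightarrow>
     smooth_on UNIV Y \<and>
     (\<forall>J K. compact K \<longrightarrow>
        uniform_limit K (\<lambda>s. iter_partial J (F s)) (iter_partial J Y) flt)"

definition is_model_vfield ::
    "('n::finite \<Rightarrow> nat) \<Rightarrow> ('n \<Rightarrow> 'a vfield) \<Rightarrow> ('a, 'n) chart \<Rightarrow> 'n \<Rightarrow>
     (real ^ 'n \<Rightarrow> real ^ 'n) \<Rightarrow> bool" where
  "is_model_vfield w X c j Y \<longleftrightarrow>
     smooth_limit (\<lambda>s x. s ^ w j *\<^sub>R dilation_pullback w s (chart_rep c (X j)) x) Y (at 0)"


subsection \<open>The tangent group and Carnot coordinates\<close>

definition structure_functions ::
    "('a::topological_space, 'n::finite) chart set \<Rightarrow> ('n \<Rightarrow> nat) \<Rightarrow> 'a set \<Rightarrow> ('n \<Rightarrow> 'a vfield) \<Rightarrow>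
     ('n \<Rightarrow> 'n \<Rightarrow> 'n \<Rightarrow> 'a \<Rightarrow> real) \<Rightarrow> bool" where
  "structure_functions A w U X L \<longleftrightarrow>
     (\<forall>i j k. smooth_fun A U (L i j k)) \<and>
     (\<forall>i j. \<forall>p\<in>U. lie_bracket A (X i) (X j) p =
        (\<lambda>f. \<Sum>k | w k \<le> w i + w j. L i j k p * X k p f))"

definition tangent_bracket ::
    "('n::finite \<Rightarrow> nat) \<Rightarrow> ('n \<Rightarrow> 'n \<Rightarrow> 'n \<Rightarrow> real) \<Rightarrow> real ^ 'n \<Rightarrow> real ^ 'n \<Rightarrow> real ^ 'n" where
  "tangent_bracket w l x y =
     (\<Sum>i\<in>UNIV. \<Sum>j\<in>UNIV. (x $ i * y $ j) *\<^sub>R (\<Sum>k | w k = w i + w j. l i j k *\<^sub>R axis k 1))"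

text \<open>The Dynkin product in step 2, where all brackets of length at least 3 vanish.\<close>

definition dynkin_prod2 ::
    "(real ^ 'n::finite \<Rightarrow> real ^ 'n \<Rightarrow> real ^ 'n) \<Rightarrow> real ^ 'n \<Rightarrow> real ^ 'n \<Rightarrow> real ^ 'n" where
  "dynkin_prod2 br x y = x + y + (1/2) *\<^sub>R br x y"

definition left_invariant ::
    "(real ^ 'n::finite \<Rightarrow> real ^ 'n \<Rightarrow> real ^ 'n) \<Rightarrow> (real ^ 'n \<Rightarrow> real ^ 'n) \<Rightarrow> bool" where
  "left_invariant mul Y \<longleftrightarrow> (\<forall>x y. Y (mul x y) = frechet_derivative (mul x) (at y) (Y y))"

text \<open>For step 2 manifolds, and for an \<open>H\<close>-frame \<open>X\<close> near \<open>a\<close>. The numbers \<open>L i j k a\<close> do not depend on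
  the choice of \<open>L\<close>, as \<open>X\<close> is a frame, and \<open>Y\<close> is determined by left invariance and its value at 0.\<close>

definition carnot_coords2 ::
    "('a::topological_space, 'n::finite) chart set \<Rightarrow> ('n \<Rightarrow> nat) \<Rightarrow> ('n \<Rightarrow> 'a vfield) \<Rightarrow> 'a \<Rightarrow>
     ('a, 'n) chart \<Rightarrow> bool" where
  "carnot_coords2 A w X a c \<longleftrightarrow>
     privileged_coords A w X a c \<and>
     (\<exists>U L. open U \<and> a \<in> U \<and> structure_functions A w U X L \<and>
        (\<forall>j. \<exists>Y. left_invariant (dynkin_prod2 (tangent_bracket w (\<lambda>i j k. L i j k a))) Y \<and>
              Y 0 = axis j 1 \<and> is_model_vfield w X c j Y))"

end

theory Submission
  imports Defs
begin

text \<open>In Darboux coordinates every \<open>X\<^sub>j - \<partial>\<^sub>j\<close> is a linear function of \<open>x\<close> times \<open>\<partial>\<^sub>t\<close>. Hence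
  \<open>X\<^sub>j\<close> is homogeneous of degree \<open>-w\<^sub>j\<close> under the dilations, so that it is its own model vector field,
  and the structure functions of the frame are constant. The resulting product on \<open>G(a)\<close> is that of
  the Heisenberg group, for which the \<open>X\<^sub>j\<close> are left-invariant. That the tangent bundle and \<open>H\<close> form a
  Carnot filtration reduces to the closure of smooth vector fields under the Lie bracket, i.e. to the
  symmetry of second derivatives.\<close>

section \<open>Smooth maps\<close>

text \<open>Few identities hold unconditionally: tangent vectors take the default value 0 on
  functions that are not smooth nearby, so linearity and the Leibniz rule need local smoothness, and
  formulas in a chart hold only on its domain. Expanding \<open>v\<close> as the sum of
  \<open>v(x_j)\<close> times the j-th coordinate vector removes the first difficulty: a tangent
  vector is known once it is evaluated on coordinate functions. For the second, the group and
  scaling computations are done with fields defined on the whole coordinate space, which agree with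
  the frame on the image of the chart; small dilations push every compact set into this image, so
  the limit in the model field is an eventual equality. All data of the frame sit in the linear
  forms \<open>vertical_part j\<close>. They ignore t, vanish for \<open>j = it\<close>, and have an
  antisymmetric coefficient matrix. By antisymmetry the structure constants are twice these
  coefficients, and the factor 1/2 of the Dynkin product undoes the 2; this is why the coefficients
  1/2 of the Darboux form give left-invariant fields exactly.\<close>

lemma has_derivative_frechet:
  "f differentiable (at x) \<Longrightarrow> (f has_derivative frechet_derivative f (at x)) (at x)"
  by (simp add: frechet_derivative_works)

lemma frechet_derivative_eqI:
  "(f has_derivative D) (at x) \<Longrightarrow> frechet_derivative f (at x) = D"
  by (metis frechet_derivative_at)

lemma differentiable_cong_open:
  assumes "f differentiable (at x)" "open S" "x \<in> S" "\<And>y. y \<in> S \<Longrightarrow> f y = g y"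
  shows "g differentiable (at x)"
  by (meson assms differentiable_def has_derivative_transform_within_open)

text \<open>Because \<open>S\<close> is open, the functions agree near each of its points and so
  have the same derivative there; the induction then passes to directional derivatives.\<close>

lemma Ck_on_cong:
  assumes "open S" "Ck_on k S f" "\<And>x. x \<in> S \<Longrightarrow> f x = g x"
  shows "Ck_on k S g"
  using assms(2,3)
proof (induction k arbitrary: f g)
  case 0
  then show ?case by (simp add: continuous_on_eq)
next
  case (Suc k)
  have "g differentiable (at x)" if "x \<in> S" for x
    using differentiable_cong_open[of f x S g] Suc.prems assms(1) that by simp
  moreover have "Ck_on k S (\<lambda>x. frechet_derivative g (at x) v)" for v
  proof (rule Suc.IH)
    show "Ck_on k S (\<lambda>x. frechet_derivative f (at x) v)" using Suc.prems by simp
    show "frechet_derivative f (at x) v = frechet_derivative g (at x) v" if "x \<in> S" for x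
      using frechet_derivative_transform_within_open[of f x S g] Suc.prems assms(1) that by simp
  qed
  ultimately show ?case by simp
qed

lemma Ck_on_subset: "Ck_on k S f \<Longrightarrow> T \<subseteq> S \<Longrightarrow> Ck_on k T f"
  by (induction k arbitrary: f) (auto intro: continuous_on_subset)

lemma Ck_on_SucD: "Ck_on (Suc k) S f \<Longrightarrow> Ck_on k S f"
proof (induction k arbitrary: f)
  case 0
  then show ?case
    by (auto intro!: continuous_at_imp_continuous_on differentiable_imp_continuous_within)
next
  case (Suc k)
  have "Ck_on k S (\<lambda>x. frechet_derivative f (at x) v)" for v
    using Suc.prems by (intro Suc.IH) simp
  then show ?case using Suc.prems by simp
qed

lemma Ck_on_const: "Ck_on k S (\<lambda>x. c)"
  by (induction k arbitrary: c) simp_all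

lemma Ck_on_bounded_linear:
  assumes "bounded_linear L"
  shows "Ck_on k S L"
proof (cases k)
  case 0
  then show ?thesis using assms by (simp add: linear_continuous_on)
next
  case (Suc n)
  have "frechet_derivative L (at x) = L" for x
    by (rule frechet_derivative_eqI) (rule bounded_linear_imp_has_derivative[OF assms])
  then show ?thesis
    using Suc by (simp add: Ck_on_const bounded_linear_imp_differentiable[OF assms])
qed

lemma Ck_on_add:
  assumes "open S" "Ck_on k S f" "Ck_on k S g"
  shows "Ck_on k S (\<lambda>x. f x + g x)"
  using assms(2,3)
proof (induction k arbitrary: f g)
  case 0
  then show ?case by (simp add: continuous_on_add)
next
  case (Suc k)
  have D: "f differentiable (at x)" "g differentiable (at x)" if "x \<in> S" for x
    using Suc.prems that by simp_all
  have "Ck_on k S (\<lambda>x. frechet_derivative (\<lambda>x. f x + g x) (at x) v)" for v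
  proof (rule Ck_on_cong[OF assms(1)])
    show "Ck_on k S (\<lambda>x. frechet_derivative f (at x) v + frechet_derivative g (at x) v)"
      using Suc by simp
    show "frechet_derivative f (at x) v + frechet_derivative g (at x) v
        = frechet_derivative (\<lambda>x. f x + g x) (at x) v" if "x \<in> S" for x
      using frechet_derivative_eqI[OF has_derivative_add[OF D[OF that, THEN has_derivative_frechet]]]
      by simp
  qed
  then show ?case using D by simp
qed

text \<open>The product rule gives two terms of the same shape, and \<open>Ck_on_SucD\<close>
  supplies the undifferentiated factors at order \<open>k\<close>. General \<open>P\<close> covers
  products, scaling and inner products at once.\<close>

lemma Ck_on_bilinear:
  assumes "bounded_bilinear P" "open S" "Ck_on k S f" "Ck_on k S g"
  shows "Ck_on k S (\<lambda>x. P (f x) (g x))"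
  using assms(3,4)
proof (induction k arbitrary: f g)
  case 0
  then show ?case by (simp add: bounded_bilinear.continuous_on[OF assms(1)])
next
  case (Suc k)
  have D: "f differentiable (at x)" "g differentiable (at x)" if "x \<in> S" for x
    using Suc.prems that by simp_all
  have FD: "((\<lambda>x. P (f x) (g x)) has_derivative
      (\<lambda>v. P (f x) (frechet_derivative g (at x) v) + P (frechet_derivative f (at x) v) (g x))) (at x)"
    if "x \<in> S" for x
    using bounded_bilinear.FDERIV[OF assms(1) D[OF that, THEN has_derivative_frechet]] .
  have "Ck_on k S (\<lambda>x. frechet_derivative (\<lambda>x. P (f x) (g x)) (at x) v)" for v
  proof (rule Ck_on_cong[OF assms(2)])
    show "Ck_on k S (\<lambda>x. P (f x) (frechet_derivative g (at x) v)
        + P (frechet_derivative f (at x) v) (g x))"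
      using Suc.prems Suc.prems[THEN Ck_on_SucD]
      by (intro Ck_on_add[OF assms(2)] Suc.IH) simp_all
    show "P (f x) (frechet_derivative g (at x) v) + P (frechet_derivative f (at x) v) (g x)
        = frechet_derivative (\<lambda>x. P (f x) (g x)) (at x) v" if "x \<in> S" for x
      using frechet_derivative_eqI[OF FD[OF that]] by simp
  qed
  then show ?case using FD by (auto simp: differentiable_def)
qed

lemma Ck_on_sum:
  assumes "open S" "\<And>i. i \<in> I \<Longrightarrow> Ck_on k S (f i)"
  shows "Ck_on k S (\<lambda>x. \<Sum>i\<in>I. f i x)"
  using assms(2)
  by (induction I rule: infinite_finite_induct) (auto intro!: Ck_on_const Ck_on_add[OF assms(1)])

text \<open>In the chain rule the derivative of \<open>g\<close> is taken in a direction that varies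
  with \<open>x\<close>, while \<open>Ck_on\<close> speaks of fixed directions. Expanding the
  direction over a finite basis repairs this, hence the Euclidean intermediate space.\<close>

lemma Ck_on_compose:
  fixes f :: "'a::real_normed_vector \<Rightarrow> 'b::euclidean_space"
  assumes "open S" "open T" "f ` S \<subseteq> T" "Ck_on k S f" "Ck_on k T g"
  shows "Ck_on k S (\<lambda>x. g (f x))"
  using assms(4,5)
proof (induction k arbitrary: g)
  case 0
  then show ?case using assms(3) by (auto intro: continuous_on_compose2)
next
  case (Suc k)
  have D: "f differentiable (at x)" "g differentiable (at (f x))" if "x \<in> S" for x
    using Suc.prems assms(3) that by auto
  have fk: "Ck_on k S f" using Suc.prems(1) by (rule Ck_on_SucD)
  have FD: "((\<lambda>x. g (f x)) has_derivative
      (\<lambda>v. frechet_derivative g (at (f x)) (frechet_derivative f (at x) v))) (at x)" if "x \<in> S" for x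
    using has_derivative_compose[OF D[OF that, THEN has_derivative_frechet]] .
  have "Ck_on k S (\<lambda>x. frechet_derivative (\<lambda>x. g (f x)) (at x) v)" for v
  proof (rule Ck_on_cong[OF assms(1)])
    show "Ck_on k S (\<lambda>x. \<Sum>b\<in>Basis. (frechet_derivative f (at x) v \<bullet> b) *\<^sub>R
        frechet_derivative g (at (f x)) b)"
    proof (intro Ck_on_sum Ck_on_bilinear[OF bounded_bilinear_scaleR] assms(1))
      fix b :: 'b
      show "Ck_on k S (\<lambda>x. frechet_derivative f (at x) v \<bullet> b)"
        using Suc.prems(1)
        by (intro Ck_on_bilinear[OF bounded_bilinear_inner] assms(1) Ck_on_const) simp
      show "Ck_on k S (\<lambda>x. frechet_derivative g (at (f x)) b)"
        using Suc.prems(2) by (intro Suc.IH fk) simp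
    qed
    show "(\<Sum>b\<in>Basis. (frechet_derivative f (at x) v \<bullet> b) *\<^sub>R frechet_derivative g (at (f x)) b)
        = frechet_derivative (\<lambda>x. g (f x)) (at x) v" if "x \<in> S" for x
    proof -
      let ?w = "frechet_derivative f (at x) v" and ?G = "frechet_derivative g (at (f x))"
      have "frechet_derivative (\<lambda>x. g (f x)) (at x) v = ?G ?w"
        using frechet_derivative_eqI[OF FD[OF that]] by simp
      also have "\<dots> = ?G (\<Sum>b\<in>Basis. (?w \<bullet> b) *\<^sub>R b)"
        by (simp add: euclidean_representation)
      also have "\<dots> = (\<Sum>b\<in>Basis. (?w \<bullet> b) *\<^sub>R ?G b)"
        using linear_frechet_derivative[OF D(2)[OF that]]
        by (simp add: linear_sum linear_scale)
      finally show ?thesis by simp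
    qed
  qed
  then show ?case using FD by (auto simp: differentiable_def)
qed

lemma smooth_onD: "smooth_on S f \<Longrightarrow> Ck_on k S f"
  by (simp add: smooth_on_def)

lemma smooth_on_cong:
  "open S \<Longrightarrow> smooth_on S f \<Longrightarrow> (\<And>x. x \<in> S \<Longrightarrow> f x = g x) \<Longrightarrow> smooth_on S g"
  unfolding smooth_on_def by (blast intro: Ck_on_cong)

lemma smooth_on_subset: "smooth_on S f \<Longrightarrow> T \<subseteq> S \<Longrightarrow> smooth_on T f"
  unfolding smooth_on_def by (blast intro: Ck_on_subset)

lemma smooth_on_const: "smooth_on S (\<lambda>x. c)"
  unfolding smooth_on_def by (simp add: Ck_on_const)

lemma smooth_on_bounded_linear: "bounded_linear L \<Longrightarrow> smooth_on S L"
  unfolding smooth_on_def by (simp add: Ck_on_bounded_linear)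

lemma smooth_on_add:
  "open S \<Longrightarrow> smooth_on S f \<Longrightarrow> smooth_on S g \<Longrightarrow> smooth_on S (\<lambda>x. f x + g x)"
  unfolding smooth_on_def by (simp add: Ck_on_add)

lemma smooth_on_mult:
  fixes f g :: "'a::real_normed_vector \<Rightarrow> real"
  shows "open S \<Longrightarrow> smooth_on S f \<Longrightarrow> smooth_on S g \<Longrightarrow> smooth_on S (\<lambda>x. f x * g x)"
  unfolding smooth_on_def by (simp add: Ck_on_bilinear[OF bounded_bilinear_mult])

lemma smooth_on_compose:
  fixes f :: "'a::real_normed_vector \<Rightarrow> 'b::euclidean_space"
  shows "open S \<Longrightarrow> open T \<Longrightarrow> f ` S \<subseteq> T \<Longrightarrow> smooth_on S f \<Longrightarrow> smooth_on T g \<Longrightarrow>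
    smooth_on S (\<lambda>x. g (f x))"
  unfolding smooth_on_def by (blast intro: Ck_on_compose)

lemma smooth_on_differentiable: "smooth_on S f \<Longrightarrow> x \<in> S \<Longrightarrow> f differentiable (at x)"
  using smooth_onD[of S f "Suc 0"] by simp

lemma smooth_on_derivative:
  assumes "smooth_on S f"
  shows "smooth_on S (\<lambda>x. frechet_derivative f (at x) v)"
  unfolding smooth_on_def
proof
  show "Ck_on k S (\<lambda>x. frechet_derivative f (at x) v)" for k
    using smooth_onD[OF assms, of "Suc k"] by simp
qed

lemma smooth_on_continuous: "smooth_on S f \<Longrightarrow> continuous_on S f"
  using smooth_onD[of S f 0] by simp

section \<open>Symmetry of second derivatives\<close>

lemma DERIV_along_line:
  fixes g :: "'a::real_normed_vector \<Rightarrow> real"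
  assumes "g differentiable (at (p + s *\<^sub>R u))"
  shows "((\<lambda>s. g (p + s *\<^sub>R u)) has_field_derivative
    frechet_derivative g (at (p + s *\<^sub>R u)) u) (at s)"
proof -
  let ?D = "frechet_derivative g (at (p + s *\<^sub>R u))"
  have "((\<lambda>s. p + s *\<^sub>R u) has_derivative (\<lambda>h. h *\<^sub>R u)) (at s)"
    by (auto intro!: derivative_eq_intros)
  from has_derivative_compose[OF this has_derivative_frechet[OF assms]]
  have "((\<lambda>s. g (p + s *\<^sub>R u)) has_derivative (\<lambda>h. ?D (h *\<^sub>R u))) (at s)" .
  moreover have "?D (h *\<^sub>R u) = ?D u * h" for h
    using linear_frechet_derivative[OF assms] by (simp add: linear_scale)
  ultimately show ?thesis by (simp add: has_field_derivative_def)
qed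

text \<open>The second difference quotient, which is symmetric in \<open>u\<close> and \<open>v\<close>, is a value of the mixed
  second derivative at a nearby point.\<close>

lemma second_difference_mean_value:
  fixes g :: "'a::real_normed_vector \<Rightarrow> real"
  assumes "smooth_on (ball x r) g" "0 < h" "h * (norm u + norm v) < r"
  obtains y where "y \<in> ball x r"
    "g (x + h *\<^sub>R u + h *\<^sub>R v) - g (x + h *\<^sub>R u) - g (x + h *\<^sub>R v) + g x
      = h\<^sup>2 * frechet_derivative (\<lambda>z. frechet_derivative g (at z) u) (at y) v"
proof -
  let ?G = "\<lambda>z. frechet_derivative g (at z) u"
  have near: "x + s *\<^sub>R u + t *\<^sub>R v \<in> ball x r" if "0 \<le> s" "s \<le> h" "0 \<le> t" "t \<le> h" for s t
  proof -
    have "norm (s *\<^sub>R u + t *\<^sub>R v) \<le> s * norm u + t * norm v"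
      using that norm_triangle_ineq[of "s *\<^sub>R u" "t *\<^sub>R v"] by simp
    also have "\<dots> \<le> h * norm u + h * norm v"
      using that by (intro add_mono mult_right_mono) auto
    finally have "norm (s *\<^sub>R u + t *\<^sub>R v) < r" using assms(3) by (simp add: algebra_simps)
    moreover have "dist x (x + s *\<^sub>R u + t *\<^sub>R v) = norm (s *\<^sub>R u + t *\<^sub>R v)"
      by (metis add.assoc add_diff_cancel_left' dist_commute dist_norm)
    ultimately show ?thesis by simp
  qed
  have Dg: "g differentiable (at z)" "?G differentiable (at z)" if "z \<in> ball x r" for z
    using that assms(1) smooth_on_derivative[of _ g u] smooth_on_differentiable by blast+
  \<comment> \<open>The second difference is the increment of \<open>\<phi>\<close> over
    \<open>[0, h]\<close>. One mean value step differentiates along \<open>u\<close>; a second one,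
    applied to that derivative, differentiates along \<open>v\<close>.\<close>
  define \<phi> where "\<phi> = (\<lambda>s. g (x + h *\<^sub>R v + s *\<^sub>R u) - g (x + s *\<^sub>R u))"
  have "(\<phi> has_field_derivative ?G (x + h *\<^sub>R v + s *\<^sub>R u) - ?G (x + s *\<^sub>R u)) (at s)"
    if "0 \<le> s" "s \<le> h" for s
    unfolding \<phi>_def
    using that near[of s h] near[of s 0] assms(2)
    by (intro DERIV_diff DERIV_along_line Dg) (simp_all add: algebra_simps)
  from MVT2[OF assms(2) this]
  obtain \<xi> where \<xi>: "0 < \<xi>" "\<xi> < h"
    "\<phi> h - \<phi> 0 = h * (?G (x + h *\<^sub>R v + \<xi> *\<^sub>R u) - ?G (x + \<xi> *\<^sub>R u))"
    by (auto simp only: diff_zero)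
  have "((\<lambda>t. ?G (x + \<xi> *\<^sub>R u + t *\<^sub>R v)) has_field_derivative
      frechet_derivative ?G (at (x + \<xi> *\<^sub>R u + t *\<^sub>R v)) v) (at t)" if "0 \<le> t" "t \<le> h" for t
    using that near[of \<xi> t] \<xi> by (intro DERIV_along_line Dg) simp_all
  from MVT2[OF assms(2) this]
  obtain \<eta> where \<eta>: "0 < \<eta>" "\<eta> < h"
    "?G (x + \<xi> *\<^sub>R u + h *\<^sub>R v) - ?G (x + \<xi> *\<^sub>R u + 0 *\<^sub>R v)
      = h * frechet_derivative ?G (at (x + \<xi> *\<^sub>R u + \<eta> *\<^sub>R v)) v"
    by (auto simp only: diff_zero)
  have "\<phi> h - \<phi> 0 = h\<^sup>2 * frechet_derivative ?G (at (x + \<xi> *\<^sub>R u + \<eta> *\<^sub>R v)) v"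
    using \<xi>(3) \<eta>(3) by (simp add: power2_eq_square algebra_simps)
  moreover have "\<phi> h - \<phi> 0
      = g (x + h *\<^sub>R u + h *\<^sub>R v) - g (x + h *\<^sub>R u) - g (x + h *\<^sub>R v) + g x"
    by (simp add: \<phi>_def algebra_simps)
  ultimately show ?thesis
    using that[of "x + \<xi> *\<^sub>R u + \<eta> *\<^sub>R v"] near[of \<xi> \<eta>] \<xi> \<eta> by simp
qed

text \<open>Near \<open>x\<close> each mixed derivative stays within half of the supposed gap from
  its value at \<open>x\<close>. But one and the same second difference is \<open>h\<^sup>2\<close>
  times either of them, at two points of that neighbourhood, so they take a common value.\<close>

lemma mixed_derivatives_commute:
  fixes g :: "'a::real_normed_vector \<Rightarrow> real"
  assumes "open S" "x \<in> S" "smooth_on S g"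
  shows "frechet_derivative (\<lambda>y. frechet_derivative g (at y) u) (at x) v =
    frechet_derivative (\<lambda>y. frechet_derivative g (at y) v) (at x) u" (is "?P x = ?Q x")
proof (rule ccontr)
  assume "?P x \<noteq> ?Q x"
  define e where "e = \<bar>?P x - ?Q x\<bar> / 2"
  have e: "e > 0" using \<open>?P x \<noteq> ?Q x\<close> by (simp add: e_def)
  have cont: "isCont (\<lambda>z. frechet_derivative (\<lambda>y. frechet_derivative g (at y) a) (at z) b) x" for a b
    using smooth_on_continuous[OF smooth_on_derivative[OF smooth_on_derivative[OF assms(3)]]]
      continuous_on_eq_continuous_at[OF assms(1)] assms(2) by metis
  obtain d1 where d1: "d1 > 0" "\<And>y. dist y x < d1 \<Longrightarrow> dist (?P y) (?P x) < e"
    using cont[of u v] e unfolding continuous_at_eps_delta by metis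
  obtain d2 where d2: "d2 > 0" "\<And>y. dist y x < d2 \<Longrightarrow> dist (?Q y) (?Q x) < e"
    using cont[of v u] e unfolding continuous_at_eps_delta by metis
  obtain r0 where r0: "r0 > 0" "ball x r0 \<subseteq> S" using assms openE by blast
  define r where "r = min r0 (min d1 d2)"
  have r: "r > 0" "smooth_on (ball x r) g"
    using r0 d1(1) d2(1) smooth_on_subset[OF smooth_on_subset[OF assms(3) r0(2)], of "ball x r"]
    by (simp_all add: r_def subset_ball)
  \<comment> \<open>The summand 1 keeps the denominator positive when \<open>u\<close> and
    \<open>v\<close> vanish, and makes the bound by \<open>r\<close> strict.\<close>
  define h where "h = r / (norm u + norm v + 1)"
  have n: "norm u + norm v + 1 > 0"
    using norm_ge_zero[of u] norm_ge_zero[of v] by linarith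
  have h: "h > 0" "h * (norm u + norm v) < r"
    using r(1) n by (simp_all add: h_def field_simps)
  obtain y where y: "y \<in> ball x r" 
    "g (x + h *\<^sub>R u + h *\<^sub>R v) - g (x + h *\<^sub>R u) - g (x + h *\<^sub>R v) + g x = h\<^sup>2 * ?P y"
    using second_difference_mean_value[OF r(2) h] .
  have "h * (norm v + norm u) < r" using h(2) by (simp add: add.commute)
  from second_difference_mean_value[OF r(2) h(1) this]
  obtain z where z: "z \<in> ball x r" 
    "g (x + h *\<^sub>R v + h *\<^sub>R u) - g (x + h *\<^sub>R v) - g (x + h *\<^sub>R u) + g x = h\<^sup>2 * ?Q z" .
  have "h\<^sup>2 * ?P y = h\<^sup>2 * ?Q z" using y(2) z(2) by (simp add: algebra_simps)
  then have eq: "?P y = ?Q z" using h(1) by simp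
  have close: "dist (?P y) (?P x) < e" "dist (?Q z) (?Q x) < e"
    using y(1) z(1) d1(2)[of y] d2(2)[of z] by (simp_all add: r_def dist_commute)
  have "dist (?P x) (?Q x) < e + e"
    using dist_triangle_less_add[of "?P x" "?P y" e "?Q x" e] close
    unfolding eq by (simp only: dist_commute)
  then show False unfolding e_def dist_real_def by (simp only: field_sum_of_halves less_irrefl)
qed

section \<open>Calculus on manifolds\<close>

lemma smooth_fun_chart:
  "smooth_fun A V f \<Longrightarrow> c \<in> A \<Longrightarrow> smooth_on (cmap c ` (V \<inter> cdom c)) (f \<circ> cinv c)"
  unfolding smooth_fun_def by blast

lemma smooth_fun_subset:
  assumes "smooth_fun A V f" "W \<subseteq> V"
  shows "smooth_fun A W f"
  unfolding smooth_fun_def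
proof
  fix c assume c: "c \<in> A"
  show "smooth_on (cmap c ` (W \<inter> cdom c)) (f \<circ> cinv c)"
    using assms(2) by (intro smooth_on_subset[OF smooth_fun_chart[OF assms(1) c]]) auto
qed

lemma smooth_fun_const: "smooth_fun A V (\<lambda>p. k)"
  unfolding smooth_fun_def comp_def by (simp add: smooth_on_const)

lemma smooth_fun_near: "open V \<Longrightarrow> p \<in> V \<Longrightarrow> smooth_fun A V f \<Longrightarrow> smooth_near A p f"
  unfolding smooth_near_def by blast

lemma tangent_cases:
  assumes "v \<in> tangent_space A p"
  obtains c u where "c \<in> A" "p \<in> cdom c" "v = chart_vec A c p u"
  using assms unfolding tangent_space_def by auto

lemma smooth_vfield_tangent: "smooth_vfield A U X \<Longrightarrow> p \<in> U \<Longrightarrow> X p \<in> tangent_space A p"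
  unfolding smooth_vfield_def by blast

lemma smooth_vfield_smooth:
  "smooth_vfield A U X \<Longrightarrow> open V \<Longrightarrow> smooth_fun A V f \<Longrightarrow> smooth_fun A (U \<inter> V) (\<lambda>p. X p f)"
  unfolding smooth_vfield_def by blast

text \<open>\<open>subbundle\<close> asks for local frames indexed by an initial segment of the
  naturals, whereas coordinate fields are indexed by the coordinate type; an enumeration transports
  the basis.\<close>

lemma is_basis_reindex:
  assumes "bij_betw e J I" "is_basis I B E"
  shows "is_basis J (\<lambda>j. B (e j)) E"
proof -
  have eq: "(\<Sum>j\<in>J. k (e j) * B (e j) f) = (\<Sum>i\<in>I. k i * B i f)" for k f
    by (rule sum.reindex_bij_betw[OF assms(1)])
  define e' where "e' = inv_into J e"
  have e': "e' (e j) = j" if "j \<in> J" for j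
    using assms(1) that by (simp add: e'_def bij_betw_def)
  have eq': "(\<Sum>j\<in>J. k j * B (e j) f) = (\<Sum>i\<in>I. k (e' i) * B i f)" for k f
    unfolding eq[of "\<lambda>i. k (e' i)", symmetric] by (simp add: e')
  show ?thesis
    unfolding is_basis_def
  proof (intro conjI allI impI ballI)
    have E: "E = {(\<lambda>f. \<Sum>i\<in>I. k i * B i f) | k. True}"
      using assms(2) unfolding is_basis_def by blast
    show "E = {(\<lambda>f. \<Sum>j\<in>J. k j * B (e j) f) | k. True}"
      unfolding E
    proof (intro set_eqI iffI; clarify)
      show "\<exists>k'. (\<lambda>f. \<Sum>i\<in>I. k i * B i f) = (\<lambda>f. \<Sum>j\<in>J. k' j * B (e j) f) \<and> True" for k
        by (intro exI[of _ "\<lambda>j. k (e j)"]) (simp add: eq)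
      show "\<exists>k'. (\<lambda>f. \<Sum>j\<in>J. k j * B (e j) f) = (\<lambda>f. \<Sum>i\<in>I. k' i * B i f) \<and> True" for k
        by (intro exI[of _ "\<lambda>i. k (e' i)"]) (simp add: eq')
    qed
    fix k j assume "(\<lambda>f. \<Sum>j\<in>J. k j * B (e j) f) = (\<lambda>f. 0)" "j \<in> J"
    then have "\<forall>i\<in>I. k (e' i) = 0"
      using assms(2) unfolding is_basis_def eq' by meson
    then show "k j = 0" using e' \<open>j \<in> J\<close> assms(1) by (metis bij_betwE)
  qed
qed

context
  fixes A :: "('a::{t2_space,second_countable_topology}, 'n::finite) chart set"
  assumes A: "smooth_structure A"
begin

lemma is_chart: "c \<in> A \<Longrightarrow> is_chart c"
  using A unfolding smooth_structure_def by blast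

lemma charts_compatible: "c \<in> A \<Longrightarrow> d \<in> A \<Longrightarrow> compatible c d"
  using A unfolding smooth_structure_def by blast

lemma chart_cover: obtains c where "c \<in> A" "p \<in> cdom c"
  using A unfolding smooth_structure_def by blast

lemma open_cdom: "c \<in> A \<Longrightarrow> open (cdom c)"
  using is_chart unfolding is_chart_def by blast

lemma cinv_cmap [simp]: "c \<in> A \<Longrightarrow> p \<in> cdom c \<Longrightarrow> cinv c (cmap c p) = p"
  using is_chart unfolding is_chart_def homeomorphism_def by blast

lemma open_chart_image:
  assumes "c \<in> A" "open V"
  shows "open (cmap c ` (V \<inter> cdom c))"
proof -
  have c: "open (cdom c)" "open (cmap c ` cdom c)"
    "homeomorphism (cdom c) (cmap c ` cdom c) (cmap c) (cinv c)"
    using is_chart[OF assms(1)] unfolding is_chart_def by auto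
  have "openin (top_of_set (cdom c)) (V \<inter> cdom c)"
    using assms(2) by (metis Int_commute openin_open_Int)
  from homeomorphism_imp_open_map[OF c(3) this] show ?thesis
    using c(2) openin_open_trans by blast
qed

lemma transition_smooth:
  "c \<in> A \<Longrightarrow> d \<in> A \<Longrightarrow> smooth_on (cmap d ` (cdom c \<inter> cdom d)) (cmap c \<circ> cinv d)"
  using charts_compatible unfolding compatible_def by blast

text \<open>Any other chart is reached by composing with a smooth transition map, so a single chart
  containing \<open>V\<close> suffices although \<open>smooth_fun\<close> quantifies over the whole
  atlas.\<close>

lemma smooth_fun_chartI:
  assumes "c \<in> A" "open V" "V \<subseteq> cdom c" "smooth_on (cmap c ` V) (f \<circ> cinv c)"
  shows "smooth_fun A V f"
  unfolding smooth_fun_def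
proof
  fix d assume d: "d \<in> A"
  let ?S = "cmap d ` (V \<inter> cdom d)"
  have S: "open ?S" using open_chart_image[OF d assms(2)] .
  have T: "open (cmap c ` V)"
    using open_chart_image[OF assms(1,2)] assms(3) by (simp add: Int_absorb2)
  have "smooth_on ?S (cmap c \<circ> cinv d)"
    using assms(3) by (intro smooth_on_subset[OF transition_smooth[OF assms(1) d]]) auto
  moreover have "(cmap c \<circ> cinv d) ` ?S \<subseteq> cmap c ` V" using d by auto
  ultimately have "smooth_on ?S (\<lambda>y. (f \<circ> cinv c) ((cmap c \<circ> cinv d) y))"
    by (intro smooth_on_compose[OF S T _ _ assms(4)])
  then show "smooth_on ?S (f \<circ> cinv d)"
    using assms d by (elim smooth_on_cong[OF S]) (auto simp: subset_iff)
qed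

lemma smooth_fun_cong:
  assumes "open V" "smooth_fun A V f" "\<And>p. p \<in> V \<Longrightarrow> f p = g p"
  shows "smooth_fun A V g"
  unfolding smooth_fun_def
proof
  fix c assume c: "c \<in> A"
  show "smooth_on (cmap c ` (V \<inter> cdom c)) (g \<circ> cinv c)"
    using assms(3) c
    by (intro smooth_on_cong[OF open_chart_image[OF c assms(1)] smooth_fun_chart[OF assms(2) c]]) auto
qed

lemma smooth_fun_add:
  assumes "open V" "smooth_fun A V f" "smooth_fun A V g"
  shows "smooth_fun A V (\<lambda>p. f p + g p)"
  unfolding smooth_fun_def
proof
  fix c assume c: "c \<in> A"
  show "smooth_on (cmap c ` (V \<inter> cdom c)) ((\<lambda>p. f p + g p) \<circ> cinv c)"
    using smooth_on_add[OF open_chart_image[OF c assms(1)] assms(2,3)[THEN smooth_fun_chart, OF c]]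
    by (simp add: comp_def)
qed

lemma smooth_fun_mult:
  assumes "open V" "smooth_fun A V f" "smooth_fun A V g"
  shows "smooth_fun A V (\<lambda>p. f p * g p)"
  unfolding smooth_fun_def
proof
  fix c assume c: "c \<in> A"
  show "smooth_on (cmap c ` (V \<inter> cdom c)) ((\<lambda>p. f p * g p) \<circ> cinv c)"
    using smooth_on_mult[OF open_chart_image[OF c assms(1)] assms(2,3)[THEN smooth_fun_chart, OF c]]
    by (simp add: comp_def)
qed

lemma smooth_fun_diff:
  assumes "open V" "smooth_fun A V f" "smooth_fun A V g"
  shows "smooth_fun A V (\<lambda>p. f p - g p)"
  using smooth_fun_add[OF assms(1,2) smooth_fun_mult[OF assms(1) smooth_fun_const[of A V "-1"] assms(3)]]
  by simp

lemma smooth_fun_sum: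
  assumes "open V" "\<And>i. i \<in> I \<Longrightarrow> smooth_fun A V (f i)"
  shows "smooth_fun A V (\<lambda>p. \<Sum>i\<in>I. f i p)"
  using assms(2)
  by (induction I rule: infinite_finite_induct)
    (auto intro!: smooth_fun_const smooth_fun_add[OF assms(1)])

lemma smooth_near_within:
  assumes "smooth_near A p f" "open W" "p \<in> W"
  obtains V where "V \<subseteq> W" "open V" "p \<in> V" "smooth_fun A V f"
proof -
  obtain U where "open U" "p \<in> U" "smooth_fun A U f"
    using assms(1) unfolding smooth_near_def by auto
  then show ?thesis
    using that[of "U \<inter> W"] assms(2,3) smooth_fun_subset[of A U f "U \<inter> W"] by auto
qed

lemma smooth_near_cong:
  assumes "open V" "p \<in> V" "\<And>q. q \<in> V \<Longrightarrow> f q = g q" "smooth_near A p f"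
  shows "smooth_near A p g"
proof -
  obtain W where W: "W \<subseteq> V" "open W" "p \<in> W" "smooth_fun A W f"
    using smooth_near_within[OF assms(4,1,2)] .
  have "smooth_fun A W g"
    using W(1) assms(3) by (intro smooth_fun_cong[OF W(2,4)]) auto
  with W(2,3) show ?thesis by (rule smooth_fun_near)
qed

lemma smooth_near_const: "smooth_near A p (\<lambda>q. k)"
  using smooth_fun_near[OF open_UNIV UNIV_I smooth_fun_const] .

lemma smooth_near_pair:
  assumes "smooth_near A p f" "smooth_near A p g"
  obtains V where "open V" "p \<in> V" "smooth_fun A V f" "smooth_fun A V g"
proof -
  obtain U where U: "open U" "p \<in> U" "smooth_fun A U f"
    using assms(1) unfolding smooth_near_def by auto
  obtain V where V: "V \<subseteq> U" "open V" "p \<in> V" "smooth_fun A V g"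
    using smooth_near_within[OF assms(2) U(1,2)] .
  show ?thesis using that[OF V(2,3) smooth_fun_subset[OF U(3) V(1)] V(4)] .
qed

lemma smooth_near_add:
  "smooth_near A p f \<Longrightarrow> smooth_near A p g \<Longrightarrow> smooth_near A p (\<lambda>q. f q + g q)"
  by (rule smooth_near_pair[of p f g]) (auto intro: smooth_fun_near smooth_fun_add)

lemma smooth_near_mult:
  "smooth_near A p f \<Longrightarrow> smooth_near A p g \<Longrightarrow> smooth_near A p (\<lambda>q. f q * g q)"
  by (rule smooth_near_pair[of p f g]) (auto intro: smooth_fun_near smooth_fun_mult)

lemma smooth_near_sum:
  "(\<And>i. i \<in> I \<Longrightarrow> smooth_near A p (f i)) \<Longrightarrow> smooth_near A p (\<lambda>q. \<Sum>i\<in>I. f i q)"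
  by (induction I rule: infinite_finite_induct) (auto intro!: smooth_near_const smooth_near_add)

lemma smooth_near_differentiable:
  assumes "smooth_near A p f" "c \<in> A" "p \<in> cdom c"
  shows "(f \<circ> cinv c) differentiable (at (cmap c p))"
proof -
  obtain V where V: "open V" "p \<in> V" "smooth_fun A V f"
    using assms(1) unfolding smooth_near_def by blast
  show ?thesis
    using smooth_on_differentiable[OF smooth_fun_chart[OF V(3) assms(2)]] V assms(3) by blast
qed

section \<open>Coordinate functions and tangent vectors\<close>

lemma smooth_fun_coord:
  assumes "c \<in> A"
  shows "smooth_fun A (cdom c) (coord c j)"
proof (rule smooth_fun_chartI[OF assms open_cdom[OF assms] order_refl])
  have "open (cmap c ` cdom c)" using is_chart[OF assms] unfolding is_chart_def by auto
  moreover have "smooth_on (cmap c ` cdom c) (\<lambda>y. y $ j)"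
    by (intro smooth_on_bounded_linear bounded_linear_vec_nth)
  ultimately show "smooth_on (cmap c ` cdom c) (coord c j \<circ> cinv c)"
    by (rule smooth_on_cong) (use assms in \<open>auto simp: coord_def\<close>)
qed

lemma smooth_near_coord: "c \<in> A \<Longrightarrow> p \<in> cdom c \<Longrightarrow> smooth_near A p (coord c j)"
  by (rule smooth_fun_near[OF open_cdom _ smooth_fun_coord])

text \<open>This is the chain rule for \<open>f \<circ> cinv d\<close>, which near the point is
  \<open>f \<circ> cinv c\<close> after the transition map; on functions that are not smooth near
  \<open>p\<close> both sides have the default value 0. Hence one chart represents all tangent
  vectors at \<open>p\<close>.\<close>

lemma chart_vec_change:
  assumes "c \<in> A" "d \<in> A" "p \<in> cdom c" "p \<in> cdom d"
  shows "chart_vec A d p u =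
    chart_vec A c p (frechet_derivative (cmap c \<circ> cinv d) (at (cmap d p)) u)"
proof
  fix f
  let ?T = "cmap c \<circ> cinv d" and ?y = "cmap d p"
  show "chart_vec A d p u f = chart_vec A c p (frechet_derivative ?T (at ?y) u) f"
  proof (cases "smooth_near A p f")
    case True
    let ?S = "cmap d ` (cdom c \<inter> cdom d)"
    have S: "open ?S" "?y \<in> ?S"
      using open_chart_image[OF assms(2) open_cdom[OF assms(1)]] assms by auto
    have T: "?T differentiable (at ?y)"
      using smooth_on_differentiable[OF transition_smooth[OF assms(1,2)] S(2)] .
    have f: "(f \<circ> cinv c) differentiable (at (?T ?y))"
      using smooth_near_differentiable[OF True assms(1,3)] assms by simp
    have "frechet_derivative (f \<circ> cinv d) (at ?y) = frechet_derivative ((f \<circ> cinv c) \<circ> ?T) (at ?y)"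
      by (rule frechet_derivative_transform_within_open
          [OF smooth_near_differentiable[OF True assms(2,4)] S]) (use assms in auto)
    also have "\<dots> = frechet_derivative (f \<circ> cinv c) (at (?T ?y)) \<circ> frechet_derivative ?T (at ?y)"
      by (rule frechet_derivative_compose[OF T f])
    finally show ?thesis using True assms by (simp add: chart_vec_def)
  qed (simp add: chart_vec_def)
qed

lemma tangent_space_chart:
  assumes "c \<in> A" "p \<in> cdom c"
  shows "tangent_space A p = range (chart_vec A c p)"
proof
  show "tangent_space A p \<subseteq> range (chart_vec A c p)"
    unfolding tangent_space_def by (auto simp: chart_vec_change[OF assms(1) _ assms(2)])
  show "range (chart_vec A c p) \<subseteq> tangent_space A p"
    using assms unfolding tangent_space_def by (auto intro!: exI[of _ "fst c"] exI[of _ "snd c"])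
qed

lemma coord_vec_tangent: "c \<in> A \<Longrightarrow> p \<in> cdom c \<Longrightarrow> coord_vec A c j p \<in> tangent_space A p"
  by (auto simp: tangent_space_chart coord_vec_def)

lemma chart_vec_expand:
  assumes "c \<in> A" "p \<in> cdom c"
  shows "chart_vec A c p u = (\<lambda>f. \<Sum>j\<in>UNIV. u $ j * coord_vec A c j p f)"
proof
  fix f
  show "chart_vec A c p u f = (\<Sum>j\<in>UNIV. u $ j * coord_vec A c j p f)"
  proof (cases "smooth_near A p f")
    case True
    let ?D = "frechet_derivative (f \<circ> cinv c) (at (cmap c p))"
    have "linear ?D"
      by (rule linear_frechet_derivative[OF smooth_near_differentiable[OF True assms]])
    then have "?D (\<Sum>j\<in>UNIV. u $ j *\<^sub>R axis j 1) = (\<Sum>j\<in>UNIV. u $ j * ?D (axis j 1))"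
      by (simp add: linear_sum linear_scale)
    then show ?thesis
      using True by (simp add: chart_vec_def coord_vec_def basis_expansion scalar_mult_eq_scaleR[symmetric])
  qed (simp add: chart_vec_def coord_vec_def)
qed

lemma coord_vec_coord:
  assumes "c \<in> A" "p \<in> cdom c"
  shows "coord_vec A c i p (coord c j) = (if i = j then 1 else 0)"
proof -
  have "open (cmap c ` cdom c)" using is_chart[OF assms(1)] unfolding is_chart_def by auto
  then have "frechet_derivative (coord c j \<circ> cinv c) (at (cmap c p))
      = frechet_derivative (\<lambda>y. y $ j) (at (cmap c p))"
    using smooth_near_differentiable[OF smooth_near_coord[OF assms] assms] assms
    by (intro frechet_derivative_transform_within_open) (auto simp: coord_def)
  also have "\<dots> = (\<lambda>y. y $ j)"
    by (intro frechet_derivative_eqI bounded_linear_imp_has_derivative bounded_linear_vec_nth)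
  finally show ?thesis
    using smooth_near_coord[OF assms] by (auto simp: coord_vec_def chart_vec_def axis_def)
qed

lemma tangentI:
  assumes "c \<in> A" "p \<in> cdom c"
  shows "(\<lambda>f. \<Sum>j\<in>UNIV. k j * coord_vec A c j p f) \<in> tangent_space A p"
proof -
  have "(\<lambda>f. \<Sum>j\<in>UNIV. k j * coord_vec A c j p f) = chart_vec A c p (\<chi> j. k j)"
    by (simp add: chart_vec_expand[OF assms])
  then show ?thesis by (simp add: tangent_space_chart[OF assms])
qed

text \<open>The coordinate vectors are dual to the coordinate functions, so evaluation on the latter
  recovers the coefficients. Later identities between tangent vectors are reduced to such
  evaluations.\<close>

lemma tangent_expand:
  assumes "c \<in> A" "p \<in> cdom c" "v \<in> tangent_space A p"
  shows "v = (\<lambda>f. \<Sum>j\<in>UNIV. v (coord c j) * coord_vec A c j p f)"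
proof -
  obtain u where u: "v = chart_vec A c p u"
    using assms(3) unfolding tangent_space_chart[OF assms(1,2)] by auto
  have "v (coord c j) = u $ j" for j
    using assms by (simp add: u chart_vec_expand coord_vec_coord if_distrib[of "\<lambda>x. _ * x"] cong: if_cong)
  then show ?thesis using chart_vec_expand[OF assms(1,2), of u] u by simp
qed

text \<open>Derivatives are local, and so is smoothness near \<open>p\<close>, so the default value
  0 is taken for both functions or for neither. This allows functions such as
  \<open>\<lambda>q. Y q f\<close> to be replaced by formulas valid only inside a chart.\<close>

lemma tangent_cong:
  assumes "v \<in> tangent_space A p" "open V" "p \<in> V" "\<And>q. q \<in> V \<Longrightarrow> f q = g q"
  shows "v f = v g"
proof -
  obtain c u where c: "c \<in> A" "p \<in> cdom c" "v = chart_vec A c p u"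
    using assms(1) by (rule tangent_cases)
  have near: "smooth_near A p f \<longleftrightarrow> smooth_near A p g"
    using assms smooth_near_cong[of V p f g] smooth_near_cong[of V p g f] by metis
  show ?thesis
  proof (cases "smooth_near A p f")
    case True
    have "frechet_derivative (f \<circ> cinv c) (at (cmap c p)) = frechet_derivative (g \<circ> cinv c) (at (cmap c p))"
      by (rule frechet_derivative_transform_within_open
          [OF smooth_near_differentiable[OF True c(1,2)] open_chart_image[OF c(1) assms(2)]])
        (use assms c in auto)
    then show ?thesis using near by (simp add: c(3) chart_vec_def)
  qed (use near in \<open>simp add: c(3) chart_vec_def\<close>)
qed

lemma tangent_const:
  assumes "v \<in> tangent_space A p"
  shows "v (\<lambda>q. k) = 0"
proof -
  obtain c u where c: "c \<in> A" "p \<in> cdom c" "v = chart_vec A c p u"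
    using assms by (rule tangent_cases)
  show ?thesis by (simp add: c(3) chart_vec_def comp_def)
qed

lemma tangent_add:
  assumes "v \<in> tangent_space A p" "smooth_near A p f" "smooth_near A p g"
  shows "v (\<lambda>q. f q + g q) = v f + v g"
proof -
  obtain c u where c: "c \<in> A" "p \<in> cdom c" "v = chart_vec A c p u"
    using assms(1) by (rule tangent_cases)
  note D = assms(2,3)[THEN smooth_near_differentiable, OF c(1,2), THEN has_derivative_frechet]
  show ?thesis
    using frechet_derivative_eqI[OF has_derivative_add[OF D]] assms smooth_near_add
    by (simp add: c(3) chart_vec_def comp_def)
qed

lemma tangent_mult:
  assumes "v \<in> tangent_space A p" "smooth_near A p f" "smooth_near A p g"
  shows "v (\<lambda>q. f q * g q) = f p * v g + v f * g p"
proof -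
  obtain c u where c: "c \<in> A" "p \<in> cdom c" "v = chart_vec A c p u"
    using assms(1) by (rule tangent_cases)
  note D = assms(2,3)[THEN smooth_near_differentiable, OF c(1,2), THEN has_derivative_frechet]
  show ?thesis
    using frechet_derivative_eqI[OF has_derivative_mult[OF D]] assms c smooth_near_mult
    by (simp add: chart_vec_def comp_def)
qed

lemma tangent_sum:
  assumes "v \<in> tangent_space A p" "\<And>i. i \<in> I \<Longrightarrow> smooth_near A p (f i)"
  shows "v (\<lambda>q. \<Sum>i\<in>I. f i q) = (\<Sum>i\<in>I. v (f i))"
  using assms(2)
  by (induction I rule: infinite_finite_induct)
    (simp_all add: tangent_const[OF assms(1)] tangent_add[OF assms(1)] smooth_near_sum)

section \<open>Coordinate fields and the Lie bracket\<close>

lemma smooth_fun_coord_vec: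
  assumes "c \<in> A" "open V" "smooth_fun A V f"
  shows "smooth_fun A (V \<inter> cdom c) (\<lambda>p. coord_vec A c j p f)"
proof (rule smooth_fun_chartI[OF assms(1)])
  show "open (V \<inter> cdom c)" using assms open_cdom by blast
  have O: "open (cmap c ` (V \<inter> cdom c))" using open_chart_image[OF assms(1,2)] .
  show "smooth_on (cmap c ` (V \<inter> cdom c)) ((\<lambda>p. coord_vec A c j p f) \<circ> cinv c)"
    using smooth_fun_near[OF assms(2) _ assms(3)] assms(1)
    by (intro smooth_on_cong[OF O smooth_on_derivative[OF smooth_fun_chart[OF assms(3,1)], of "axis j 1"]])
      (auto simp: coord_vec_def chart_vec_def)
qed simp

lemma smooth_near_coord_vec:
  assumes "c \<in> A" "p \<in> cdom c" "smooth_near A p f"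
  shows "smooth_near A p (\<lambda>q. coord_vec A c j q f)"
proof -
  obtain V where "open V" "p \<in> V" "smooth_fun A V f"
    using assms(3) unfolding smooth_near_def by blast
  then show ?thesis
    using smooth_fun_near[OF _ _ smooth_fun_coord_vec[OF assms(1)], of V] open_cdom assms by blast
qed

text \<open>The inner derivative is a partial derivative of \<open>f \<circ> cinv c\<close> on a
  whole neighbourhood, not only at the point; differentiating once more gives a mixed second
  derivative in the chart, which is symmetric.\<close>

lemma coord_vec_commute:
  assumes "c \<in> A" "p \<in> cdom c" "smooth_near A p f"
  shows "coord_vec A c i p (\<lambda>q. coord_vec A c j q f) = coord_vec A c j p (\<lambda>q. coord_vec A c i q f)"
proof -
  obtain V where V: "open V" "p \<in> V" "smooth_fun A V f"
    using assms(3) unfolding smooth_near_def by blast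
  let ?S = "cmap c ` (V \<inter> cdom c)" and ?h = "f \<circ> cinv c"
  have S: "open ?S" "cmap c p \<in> ?S" "smooth_on ?S ?h"
    using open_chart_image[OF assms(1) V(1)] V(2) assms(1,2) smooth_fun_chart[OF V(3) assms(1)] by auto
  have "coord_vec A c i p (\<lambda>q. coord_vec A c j q f)
      = frechet_derivative (\<lambda>y. frechet_derivative ?h (at y) (axis j 1)) (at (cmap c p)) (axis i 1)" for i j
  proof -
    have near: "smooth_near A p (\<lambda>q. coord_vec A c j q f)" by (rule smooth_near_coord_vec[OF assms])
    have "frechet_derivative ((\<lambda>q. coord_vec A c j q f) \<circ> cinv c) (at (cmap c p))
        = frechet_derivative (\<lambda>y. frechet_derivative ?h (at y) (axis j 1)) (at (cmap c p))"
      by (rule frechet_derivative_transform_within_open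
          [OF smooth_near_differentiable[OF near assms(1,2)] S(1,2)])
        (use smooth_fun_near[OF V(1) _ V(3)] assms(1) in \<open>auto simp: coord_vec_def chart_vec_def\<close>)
    then show ?thesis using near by (simp add: coord_vec_def[of A c i] chart_vec_def)
  qed
  then show ?thesis using mixed_derivatives_commute[OF S] by simp
qed

lemma smooth_vfield_near:
  assumes "smooth_vfield A U X" "open U" "p \<in> U" "smooth_near A p f"
  shows "smooth_near A p (\<lambda>q. X q f)"
proof -
  obtain V where "open V" "p \<in> V" "smooth_fun A V f"
    using assms(4) unfolding smooth_near_def by blast
  then show ?thesis
    using smooth_fun_near[OF _ _ smooth_vfield_smooth[OF assms(1)], of V] assms by blast
qed

lemma smooth_vfieldI:
  assumes "c \<in> A" "open U" "U \<subseteq> cdom c" "\<And>j. smooth_fun A U (g j)"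
    "\<And>p. p \<in> U \<Longrightarrow> X p = (\<lambda>f. \<Sum>j\<in>UNIV. g j p * coord_vec A c j p f)"
  shows "smooth_vfield A U X"
  unfolding smooth_vfield_def
proof (intro conjI ballI allI impI)
  show "X p \<in> tangent_space A p" if "p \<in> U" for p
    using tangentI[OF assms(1), of p "\<lambda>j. g j p"] assms(3,5) that by auto
  fix V f assume V: "open V \<and> smooth_fun A V f"
  then have O: "open (U \<inter> V)" using assms(2) by blast
  have "smooth_fun A (U \<inter> V) (\<lambda>p. \<Sum>j\<in>UNIV. g j p * coord_vec A c j p f)"
  proof (intro smooth_fun_sum smooth_fun_mult O)
    show "smooth_fun A (U \<inter> V) (g j)" for j using assms(4) by (rule smooth_fun_subset) simp
    show "smooth_fun A (U \<inter> V) (\<lambda>p. coord_vec A c j p f)" for j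
      using smooth_fun_coord_vec[OF assms(1), of V f] V assms(3) by (blast intro: smooth_fun_subset)
  qed
  then show "smooth_fun A (U \<inter> V) (\<lambda>p. X p f)"
    by (rule smooth_fun_cong[OF O]) (simp add: assms(5))
qed

text \<open>The Leibniz rule applied to the coordinate expansion of \<open>Y q f\<close> separates a
  first-order part, which survives in the bracket, from a second-order part.\<close>

lemma vfield_compose_expand:
  assumes "c \<in> A" "open U" "smooth_vfield A U X" "smooth_vfield A U Y"
    "p \<in> U" "p \<in> cdom c" "smooth_near A p f"
  shows "X p (\<lambda>q. Y q f) = (\<Sum>i\<in>UNIV. X p (\<lambda>q. Y q (coord c i)) * coord_vec A c i p f) +
    (\<Sum>i\<in>UNIV. \<Sum>j\<in>UNIV. Y p (coord c i) * X p (coord c j) *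
       coord_vec A c j p (\<lambda>q. coord_vec A c i q f))"
proof -
  note Xp = smooth_vfield_tangent[OF assms(3,5)]
  have nY: "smooth_near A p (\<lambda>q. Y q (coord c i))" for i
    by (rule smooth_vfield_near[OF assms(4,2,5) smooth_near_coord[OF assms(1,6)]])
  have nD: "smooth_near A p (\<lambda>q. coord_vec A c i q f)" for i
    by (rule smooth_near_coord_vec[OF assms(1,6,7)])
  have "X p (\<lambda>q. Y q f) = X p (\<lambda>q. \<Sum>i\<in>UNIV. Y q (coord c i) * coord_vec A c i q f)"
  proof (rule tangent_cong[OF Xp])
    show "open (U \<inter> cdom c)" by (intro open_Int assms(2) open_cdom[OF assms(1)])
    show "p \<in> U \<inter> cdom c" using assms(5,6) by simp
    show "Y q f = (\<Sum>i\<in>UNIV. Y q (coord c i) * coord_vec A c i q f)" if "q \<in> U \<inter> cdom c" for q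
      using fun_cong[OF tangent_expand[OF assms(1) _ smooth_vfield_tangent[OF assms(4)], of q], of f] that
      by simp
  qed
  also have "\<dots> = (\<Sum>i\<in>UNIV. X p (\<lambda>q. Y q (coord c i) * coord_vec A c i q f))"
    by (intro tangent_sum[OF Xp] smooth_near_mult nY nD)
  also have "\<dots> = (\<Sum>i\<in>UNIV. Y p (coord c i) * X p (\<lambda>q. coord_vec A c i q f)
      + X p (\<lambda>q. Y q (coord c i)) * coord_vec A c i p f)"
    by (simp add: tangent_mult[OF Xp nY nD])
  also have "\<dots> = (\<Sum>i\<in>UNIV. Y p (coord c i) *
       (\<Sum>j\<in>UNIV. X p (coord c j) * coord_vec A c j p (\<lambda>q. coord_vec A c i q f))
      + X p (\<lambda>q. Y q (coord c i)) * coord_vec A c i p f)"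
    by (intro sum.cong refl arg_cong2[where f = "(+)"] arg_cong2[where f = "(*)"]
        fun_cong[OF tangent_expand[OF assms(1,6) Xp]])
  finally show ?thesis by (simp add: sum.distrib sum_distrib_left mult.assoc add.commute)
qed

text \<open>The second-order parts of both compositions coincide after exchanging the summation
  indices, since coordinate derivatives commute. What remains has order one, so the bracket is again
  a tangent vector.\<close>

lemma lie_bracket_expand:
  assumes "c \<in> A" "open U" "smooth_vfield A U X" "smooth_vfield A U Y" "p \<in> U" "p \<in> cdom c"
  shows "lie_bracket A X Y p = (\<lambda>f. \<Sum>i\<in>UNIV.
    (X p (\<lambda>q. Y q (coord c i)) - Y p (\<lambda>q. X q (coord c i))) * coord_vec A c i p f)"
proof
  fix f
  show "lie_bracket A X Y p f = (\<Sum>i\<in>UNIV.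
    (X p (\<lambda>q. Y q (coord c i)) - Y p (\<lambda>q. X q (coord c i))) * coord_vec A c i p f)"
  proof (cases "smooth_near A p f")
    case True
    let ?B = "\<lambda>i j. coord_vec A c j p (\<lambda>q. coord_vec A c i q f)"
    have "(\<Sum>i\<in>UNIV. \<Sum>j\<in>UNIV. Y p (coord c i) * X p (coord c j) * ?B i j)
        = (\<Sum>j\<in>UNIV. \<Sum>i\<in>UNIV. Y p (coord c i) * X p (coord c j) * ?B i j)"
      by (rule sum.swap)
    also have "\<dots> = (\<Sum>i\<in>UNIV. \<Sum>j\<in>UNIV. X p (coord c i) * Y p (coord c j) * ?B i j)"
      by (intro sum.cong refl) (simp add: coord_vec_commute[OF assms(1,6) True] mult.commute)
    finally show ?thesis
      using True vfield_compose_expand[OF assms True] vfield_compose_expand[OF assms(1,2,4,3,5,6) True]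
      by (simp add: lie_bracket_def sum_subtractf left_diff_distrib)
  qed (simp add: lie_bracket_def coord_vec_def chart_vec_def)
qed

lemma smooth_vfield_lie_bracket:
  assumes "open U" "smooth_vfield A U X" "smooth_vfield A U Y"
  shows "smooth_vfield A U (lie_bracket A X Y)"
  unfolding smooth_vfield_def
proof (intro conjI ballI allI impI)
  fix p assume p: "p \<in> U"
  obtain c where c: "c \<in> A" "p \<in> cdom c" by (rule chart_cover)
  show "lie_bracket A X Y p \<in> tangent_space A p"
    using lie_bracket_expand[OF c(1) assms p c(2)] tangentI[OF c] by simp
next
  fix V f assume V: "open V \<and> smooth_fun A V f"
  then have O: "open (U \<inter> V)" using assms(1) by blast
  have XY: "smooth_fun A (U \<inter> V) (\<lambda>p. X p (\<lambda>q. Y q f))"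
    if "smooth_vfield A U X" "smooth_vfield A U Y" for X Y
    using smooth_vfield_smooth[OF that(1) O smooth_vfield_smooth[OF that(2)], of f] V by simp
  have "smooth_near A p f" if "p \<in> U \<inter> V" for p
    using that V smooth_fun_near[of V p A f] by simp
  then show "smooth_fun A (U \<inter> V) (\<lambda>p. lie_bracket A X Y p f)"
    by (intro smooth_fun_cong[OF O smooth_fun_diff[OF O XY[OF assms(2,3)] XY[OF assms(3,2)]]])
      (simp add: lie_bracket_def)
qed

lemma coord_vec_smooth_vfield:
  assumes "c \<in> A"
  shows "smooth_vfield A (cdom c) (coord_vec A c j)"
proof (rule smooth_vfieldI[OF assms open_cdom[OF assms] order_refl])
  show "smooth_fun A (cdom c) (\<lambda>p. if i = j then 1 else 0)" for i
    by (rule smooth_fun_const)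
  fix p assume "p \<in> cdom c"
  from tangent_expand[OF assms this coord_vec_tangent[OF assms this, of j]]
  show "coord_vec A c j p = (\<lambda>f. \<Sum>i\<in>UNIV. (if i = j then 1 else 0) * coord_vec A c i p f)"
    unfolding coord_vec_coord[OF assms \<open>p \<in> cdom c\<close>] eq_commute[of j] .
qed

lemma coord_vec_basis:
  assumes "c \<in> A" "p \<in> cdom c"
  shows "is_basis UNIV (\<lambda>j. coord_vec A c j p) (tangent_space A p)"
  unfolding is_basis_def
proof (intro conjI allI impI ballI set_eqI iffI)
  fix v assume "v \<in> tangent_space A p"
  from tangent_expand[OF assms this]
  show "v \<in> {(\<lambda>f. \<Sum>j\<in>UNIV. k j * coord_vec A c j p f) | k. True}" by auto
next
  fix v assume "v \<in> {(\<lambda>f. \<Sum>j\<in>UNIV. k j * coord_vec A c j p f) | k. True}"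
  then show "v \<in> tangent_space A p" using tangentI[OF assms] by auto
next
  fix k j assume "(\<lambda>f. \<Sum>j\<in>UNIV. k j * coord_vec A c j p f) = (\<lambda>f. 0)"
  then have "(\<Sum>i\<in>UNIV. k i * coord_vec A c i p (coord c j)) = 0" by (rule fun_cong)
  then show "k j = 0"
    by (simp add: coord_vec_coord[OF assms] if_distrib[of "\<lambda>x. _ * x"] cong: if_cong)
qed

lemma subbundle_tangent_space: "subbundle A (tangent_space A) CARD('n)"
  unfolding subbundle_def
proof
  fix p
  obtain c where c: "c \<in> A" "p \<in> cdom c" by (rule chart_cover)
  obtain e :: "nat \<Rightarrow> 'n" where e: "bij_betw e {..<CARD('n)} UNIV"
    using ex_bij_betw_nat_finite[of "UNIV :: 'n set"] by (auto simp: lessThan_atLeast0)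
  show "\<exists>U X. open U \<and> p \<in> U \<and> (\<forall>j<CARD('n). smooth_vfield A U (X j)) \<and>
      (\<forall>q\<in>U. is_basis {..<CARD('n)} (\<lambda>j. X j q) (tangent_space A q))"
    using c open_cdom coord_vec_smooth_vfield is_basis_reindex[OF e coord_vec_basis]
    by (intro exI[of _ "cdom c"] exI[of _ "\<lambda>j. coord_vec A c (e j)"]) auto
qed

end

section \<open>The frame of Darboux coordinates\<close>

text \<open>The \<open>t\<close>-component of the vector fields \<open>X\<^sub>j - \<partial>\<^sub>j\<close>.\<close>

fun vertical_part :: "'m::finite cindex \<Rightarrow> real ^ ('m cindex) \<Rightarrow> real" where
  "vertical_part (Inl (Inl l)) x = - (1/2) * x $ iy l"
| "vertical_part (Inl (Inr l)) x = 1/2 * x $ ix l"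
| "vertical_part (Inr _) x = 0"

text \<open>The coordinate expression of the Darboux frame, extended to the whole space. It serves
  both as the model field and as the left-invariant field on the tangent group.\<close>

definition heisenberg_field :: "'m::finite cindex \<Rightarrow> real ^ ('m cindex) \<Rightarrow> real ^ ('m cindex)" where
  "heisenberg_field j x = axis j 1 + vertical_part j x *\<^sub>R axis it 1"

text \<open>The coefficients of the bracket of the i-th and j-th frame fields: differentiating the
  linear form \<open>vertical_part j\<close> along the i-th field gives its value at
  \<open>axis i 1\<close>. For the pair \<open>ix l\<close>, \<open>iy l\<close> the coefficient of
  \<open>it\<close> is 1/2 + 1/2 = 1.\<close>

definition heisenberg_const :: "'m::finite cindex \<Rightarrow> 'm cindex \<Rightarrow> 'm cindex \<Rightarrow> real" where
  "heisenberg_const i j k =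
    (if k = it then vertical_part j (axis i 1) - vertical_part i (axis j 1) else 0)"

section \<open>The Heisenberg group and its left-invariant fields\<close>

lemma cindex_cases:
  obtains l where "j = ix l" | l where "j = iy l" | "j = it"
  by (metis old.unit.exhaust sum.exhaust)

lemma bounded_linear_vertical_part: "bounded_linear (\<lambda>x. vertical_part j x)"
  by (cases j rule: cindex_cases)
    (simp_all only: vertical_part.simps,
      auto intro!: bounded_linear_compose[OF bounded_linear_divide bounded_linear_vec_nth]
        bounded_linear_minus bounded_linear_zero)

lemma linear_vertical_part: "linear (vertical_part j)"
  by (rule bounded_linear.linear[OF bounded_linear_vertical_part])

lemma vertical_part_it [simp]: "vertical_part j (axis it 1) = 0"
  by (cases j rule: cindex_cases) (simp_all add: axis_def)

text \<open>The coefficients of the vertical parts are half of the standard symplectic matrix,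
  bordered by zeros at \<open>it\<close>.\<close>

lemma vertical_part_antisym: "vertical_part i (axis j 1) = - vertical_part j (axis i 1)"
  by (cases i rule: cindex_cases; cases j rule: cindex_cases) (auto simp: axis_def)

lemma heisenberg_field_nth:
  "heisenberg_field j x $ k = (if k = j then 1 else 0) + (if k = it then vertical_part j x else 0)"
  by (simp add: heisenberg_field_def axis_def)

lemma vertical_part_heisenberg_field:
  "vertical_part i (heisenberg_field j x) = vertical_part i (axis j 1)"
  using linear_vertical_part[of i] by (simp add: heisenberg_field_def linear_add linear_scale)

text \<open>Only the component \<open>it\<close> survives, and antisymmetry merges the two terms of
  \<open>heisenberg_const\<close> into the factor 2, which the Dynkin product halves again.\<close>

lemma heisenberg_bracket:
  "tangent_bracket contact_weight heisenberg_const x y =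
    (2 * (\<Sum>j\<in>UNIV. y $ j * vertical_part j x)) *\<^sub>R axis it 1"
proof -
  let ?v = "\<lambda>i j. vertical_part j (axis i 1 :: real ^ ('a cindex))"
  have c: "(\<Sum>k | contact_weight k = contact_weight i + contact_weight j.
      heisenberg_const i j k *\<^sub>R axis k 1) = (2 * ?v i j) *\<^sub>R axis it (1::real)" for i j :: "'a cindex"
  proof -
    have "(\<Sum>k | contact_weight k = contact_weight i + contact_weight j.
        heisenberg_const i j k *\<^sub>R axis k (1::real)) =
        (if contact_weight i + contact_weight j = 2 then heisenberg_const i j it *\<^sub>R axis it 1 else 0)"
      by (subst sum.mono_neutral_cong_right[of _ "if contact_weight i + contact_weight j = 2 then {it} else {}"])
        (auto simp: heisenberg_const_def)
    \<comment> \<open>The weights add up to 2 exactly when neither index is \<open>it\<close>.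
      Otherwise the left side is 0, and so is the right side, because
      \<open>vertical_part it\<close> and every vertical part at \<open>axis it 1\<close>
      vanish.\<close>
    also have "\<dots> = (2 * ?v i j) *\<^sub>R axis it 1"
      using vertical_part_antisym[of i j]
      by (cases i; cases j) (auto simp: heisenberg_const_def)
    finally show ?thesis .
  qed
  have lin: "vertical_part j x = (\<Sum>i\<in>UNIV. x $ i * ?v i j)" for j
  proof -
    have "vertical_part j x = vertical_part j (\<Sum>i\<in>UNIV. x $ i *\<^sub>R axis i 1)"
      by (simp add: basis_expansion scalar_mult_eq_scaleR[symmetric])
    also have "\<dots> = (\<Sum>i\<in>UNIV. x $ i * ?v i j)"
      using linear_vertical_part[of j] by (simp add: linear_sum linear_scale)
    finally show ?thesis .
  qed
  have "tangent_bracket contact_weight heisenberg_const x y =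
      (\<Sum>i\<in>UNIV. \<Sum>j\<in>UNIV. (2 * (y $ j * (x $ i * ?v i j))) *\<^sub>R axis it 1)"
    unfolding tangent_bracket_def c by (simp add: mult_ac)
  also have "\<dots> = (\<Sum>j\<in>UNIV. \<Sum>i\<in>UNIV. (2 * (y $ j * (x $ i * ?v i j))) *\<^sub>R axis it 1)"
    by (rule sum.swap)
  also have "\<dots> = (\<Sum>j\<in>UNIV. (2 * (y $ j * vertical_part j x)) *\<^sub>R axis it 1)"
    unfolding lin by (simp add: scaleR_sum_left[symmetric] sum_distrib_left)
  finally show ?thesis by (simp add: scaleR_sum_left[symmetric] sum_distrib_left)
qed

text \<open>Left translation is affine in \<open>y\<close> with linear part
  \<open>h + ?W h *\<^sub>R axis it 1\<close>, and \<open>?W\<close> maps the j-th field to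
  \<open>vertical_part j x\<close>, its t-component being killed by
  \<open>vertical_part it = 0\<close>. This is the amount by which \<open>vertical_part j\<close>
  grows from \<open>y\<close> to the product, as it is additive and ignores t.\<close>

lemma left_invariant_heisenberg_field:
  "left_invariant (dynkin_prod2 (tangent_bracket contact_weight heisenberg_const)) (heisenberg_field j)"
  unfolding left_invariant_def
proof (intro allI)
  fix x y :: "real ^ ('a cindex)"
  let ?mul = "dynkin_prod2 (tangent_bracket contact_weight heisenberg_const)"
  let ?W = "\<lambda>y. \<Sum>j\<in>UNIV. y $ j * vertical_part j x"
  have mul: "?mul x = (\<lambda>y. x + y + ?W y *\<^sub>R axis it 1)"
    by (simp add: fun_eq_iff dynkin_prod2_def heisenberg_bracket)
  have "(?mul x has_derivative (\<lambda>h. h + ?W h *\<^sub>R axis it 1)) (at y)"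
    unfolding mul
    by (auto intro!: derivative_eq_intros bounded_linear_imp_has_derivative[OF bounded_linear_vec_nth])
  then have "frechet_derivative (?mul x) (at y) (heisenberg_field j y)
      = heisenberg_field j y + ?W (heisenberg_field j y) *\<^sub>R axis it 1"
    by (simp add: frechet_derivative_eqI)
  moreover have "?W (heisenberg_field j y) = vertical_part j x"
    by (simp add: heisenberg_field_nth distrib_right sum.distrib if_distrib[of "\<lambda>x. x * _"] cong: if_cong)
  moreover have "vertical_part j (?mul x y) = vertical_part j x + vertical_part j y"
    using linear_vertical_part[of j] by (simp add: mul linear_add linear_scale)
  ultimately show "heisenberg_field j (?mul x y)
      = frechet_derivative (?mul x) (at y) (heisenberg_field j y)"
    by (simp add: heisenberg_field_def scaleR_add_left)
qed

section \<open>Homogeneity and limits under dilations\<close>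

lemma smooth_heisenberg_field: "smooth_on UNIV (heisenberg_field j)"
proof -
  have "smooth_on UNIV (\<lambda>x. axis j 1 + vertical_part j x *\<^sub>R axis it (1::real))"
    by (intro smooth_on_add smooth_on_const smooth_on_bounded_linear bounded_linear_scaleR_const
        bounded_linear_vertical_part open_UNIV)
  then show ?thesis by (simp add: heisenberg_field_def[abs_def])
qed

text \<open>For a horizontal field the vertical coefficient scales by \<open>s\<close>, since it
  involves only coordinates of weight 1; with the prefactor \<open>s\<close> this cancels the
  division by \<open>s\<^sup>2\<close> in the t-component.\<close>

lemma heisenberg_field_dilation:
  assumes "s \<noteq> 0"
  shows "s ^ contact_weight j *\<^sub>R dilation_pullback contact_weight s (heisenberg_field j) x
    = heisenberg_field j x"
proof -
  have "vertical_part j (dilation contact_weight s x) = s * vertical_part j x"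
    by (cases j rule: cindex_cases) (simp_all add: dilation_def)
  then show ?thesis
    using assms by (cases j)
      (auto simp: vec_eq_iff dilation_pullback_def heisenberg_field_nth power2_eq_square)
qed

text \<open>No differentiability is assumed: \<open>frechet_derivative\<close> is chosen by a
  predicate that is itself local. Iterated partials of a chart representation can thus be compared
  without first proving it smooth.\<close>

lemma frechet_derivative_cong_open:
  assumes "open S" "x \<in> S" "\<And>y. y \<in> S \<Longrightarrow> f y = g y"
  shows "frechet_derivative f (at x) = frechet_derivative g (at x)"
proof -
  have "(f has_derivative D) (at x) \<longleftrightarrow> (g has_derivative D) (at x)" for D
    using has_derivative_transform_within_open[of f D x UNIV S g]
      has_derivative_transform_within_open[of g D x UNIV S f] assms by auto
  then show ?thesis by (simp add: frechet_derivative_def)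
qed

lemma iter_partial_cong_open:
  assumes "open S" "x \<in> S" "\<And>y. y \<in> S \<Longrightarrow> f y = g y"
  shows "iter_partial J f x = iter_partial J g x"
  using assms(2)
proof (induction J arbitrary: x)
  case Nil
  then show ?case by (simp add: assms(3))
next
  case (Cons j J)
  then show ?case
    using frechet_derivative_cong_open[OF assms(1), of x "iter_partial J f" "iter_partial J g"] by simp
qed

text \<open>A compact set lies in an open ball, and equality on an open set passes to all iterated
  partials, so the uniform distance is eventually 0.\<close>

lemma smooth_limit_eventually_eq:
  assumes "smooth_on UNIV Y" "\<And>r. r > 0 \<Longrightarrow> \<forall>\<^sub>F s in F. \<forall>x\<in>ball 0 r. G s x = Y x"
  shows "smooth_limit G Y F"
  unfolding smooth_limit_def
proof (intro conjI allI impI assms(1))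
  fix J and K :: "(real ^ 'a) set" assume "compact K"
  then obtain r where r: "r > 0" "K \<subseteq> ball 0 r"
    using bounded_subset_ballD[OF compact_imp_bounded] by blast
  show "uniform_limit K (\<lambda>s. iter_partial J (G s)) (iter_partial J Y) F"
  proof (rule uniform_limitI)
    fix e :: real assume "e > 0"
    show "\<forall>\<^sub>F s in F. \<forall>x\<in>K. dist (iter_partial J (G s) x) (iter_partial J Y x) < e"
      using assms(2)[OF r(1)]
    proof eventually_elim
      case (elim s)
      have "iter_partial J (G s) x = iter_partial J Y x" if "x \<in> K" for x
        using that r(2) elim by (intro iter_partial_cong_open[OF open_ball[of 0 r]]) auto
      then show ?case using \<open>e > 0\<close> by simp
    qed
  qed
qed

lemma norm_dilation_le:
  assumes "\<And>j. 1 \<le> w j" "\<bar>s\<bar> \<le> 1"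
  shows "norm (dilation w s x) \<le> \<bar>s\<bar> * norm x"
proof -
  have "\<bar>s ^ w j\<bar> \<le> \<bar>s\<bar>" for j
    using power_decreasing[OF assms(1)[of j], of "\<bar>s\<bar>"] assms(2) by (simp add: power_abs)
  then have "norm (dilation w s x $ j) \<le> norm ((\<bar>s\<bar> *\<^sub>R x) $ j)" for j
    by (simp add: dilation_def abs_mult mult_right_mono)
  then have "norm (dilation w s x) \<le> norm (\<bar>s\<bar> *\<^sub>R x)" by (rule norm_le_componentwise_cart)
  then show ?thesis by simp
qed

text \<open>Weights at least 1 give norm at most \<open>\<bar>s\<bar> * norm x\<close> once
  \<open>\<bar>s\<bar> \<le> 1\<close>. With \<open>S\<close> the image of the chart, this keeps the
  rescaled field where \<open>chart_rep\<close> is meaningful.\<close>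

lemma eventually_dilation_in:
  assumes "\<And>j. 1 \<le> w j" "open S" "0 \<in> S" "r > 0"
  shows "\<forall>\<^sub>F s in at 0. \<forall>x\<in>ball 0 r. dilation w s x \<in> S"
proof -
  obtain e where e: "e > 0" "ball 0 e \<subseteq> S" using assms(2,3) openE by blast
  have "dilation w s x \<in> S" if "\<bar>s\<bar> < min 1 (e / r)" "x \<in> ball 0 r" for s x
  proof -
    have "norm (dilation w s x) \<le> \<bar>s\<bar> * norm x"
      using that by (intro norm_dilation_le assms(1)) auto
    also have "\<dots> \<le> \<bar>s\<bar> * r" using that by (intro mult_left_mono) auto
    also have "\<dots> < e" using that assms(4) by (simp add: field_simps)
    finally show ?thesis using e(2) by auto
  qed
  then show ?thesis
    unfolding eventually_at using e(1) assms(4)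
    by (intro exI[of _ "min 1 (e / r)"]) (auto simp: dist_real_def)
qed

lemma contact_weight_ge: "1 \<le> contact_weight j" and contact_weight_le: "contact_weight j \<le> 2"
  by (cases j; simp)+

lemma contact_weight_le_1_iff: "contact_weight j \<le> 1 \<longleftrightarrow> j \<noteq> it"
  by (cases j rule: cindex_cases) simp_all

context
  fixes A :: "('a::{t2_space,second_countable_topology}, 'm::finite cindex) chart set"
    and c :: "('a, 'm cindex) chart"
  assumes A: "smooth_structure A" and c: "c \<in> A"
begin

section \<open>The Darboux frame in its chart\<close>

lemma darboux_frame_eq:
  "darboux_frame A c j p =
    (\<lambda>f. coord_vec A c j p f + vertical_part j (cmap c p) * coord_vec A c it p f)"
  by (cases j rule: cindex_cases) (simp_all add: coord_def fun_eq_iff)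

lemma darboux_frame_expand:
  "darboux_frame A c j p = (\<lambda>f. \<Sum>k\<in>UNIV. heisenberg_field j (cmap c p) $ k * coord_vec A c k p f)"
  by (simp add: darboux_frame_eq heisenberg_field_nth distrib_right sum.distrib
      if_distrib[of "\<lambda>x. x * _"] cong: if_cong)

lemma darboux_frame_coord:
  "p \<in> cdom c \<Longrightarrow> darboux_frame A c j p (coord c k) = heisenberg_field j (cmap c p) $ k"
  by (simp add: darboux_frame_expand coord_vec_coord[OF A c] if_distrib[of "\<lambda>x. _ * x"] cong: if_cong)

lemma smooth_fun_vertical_part: "smooth_fun A (cdom c) (\<lambda>p. vertical_part j (cmap c p))"
proof -
  have "smooth_fun A (cdom c) (\<lambda>p. k * coord c i p)" for k i
    by (intro smooth_fun_mult[OF A open_cdom[OF A c]] smooth_fun_const smooth_fun_coord[OF A c])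
  from this[of "-1/2"] this[of "1/2"] show ?thesis
    by (cases j rule: cindex_cases) (simp_all add: coord_def smooth_fun_const)
qed

lemma smooth_vfield_darboux_frame: "smooth_vfield A (cdom c) (darboux_frame A c j)"
proof (rule smooth_vfieldI[OF A c open_cdom[OF A c] order_refl])
  show "smooth_fun A (cdom c) (\<lambda>p. heisenberg_field j (cmap c p) $ k)" for k
    unfolding heisenberg_field_nth
    by (cases "k = it"; simp only: if_True if_False simp_thms)
      (intro smooth_fun_add[OF A open_cdom[OF A c]] smooth_fun_const smooth_fun_vertical_part)+
  show "darboux_frame A c j p =
      (\<lambda>f. \<Sum>k\<in>UNIV. heisenberg_field j (cmap c p) $ k * coord_vec A c k p f)" for p
    by (rule darboux_frame_expand)
qed

lemmas darboux_frame_tangent = smooth_vfield_tangent[OF smooth_vfield_darboux_frame]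

text \<open>The passage from the coordinate basis is unipotent: only the coefficient of
  \<open>it\<close> changes, by a sum over the other coefficients.\<close>

lemma darboux_frame_basis:
  assumes p: "p \<in> cdom c"
  shows "is_basis UNIV (\<lambda>j. darboux_frame A c j p) (tangent_space A p)"
proof -
  let ?x = "cmap c p"
  have comb: "(\<Sum>j\<in>UNIV. k j * darboux_frame A c j p f) = (\<Sum>j\<in>UNIV. k j * coord_vec A c j p f) +
      (\<Sum>j\<in>UNIV. k j * vertical_part j ?x) * coord_vec A c it p f" for k f
    by (simp add: darboux_frame_eq distrib_left sum.distrib sum_distrib_right mult.assoc)
  have B: "is_basis UNIV (\<lambda>j. coord_vec A c j p) (tangent_space A p)"
    by (rule coord_vec_basis[OF A c p])
  show ?thesis
    unfolding is_basis_def
  proof (intro conjI allI impI ballI set_eqI iffI)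
    fix v assume v: "v \<in> tangent_space A p"
    let ?S = "\<Sum>j\<in>UNIV. v (coord c j) * vertical_part j ?x"
    \<comment> \<open>Subtracting \<open>?S\<close> at \<open>it\<close> compensates the vertical
      parts, and \<open>?S\<close> itself is unaffected since \<open>vertical_part it\<close>
      vanishes.\<close>
    define k where "k = (\<lambda>j. v (coord c j) - (if j = it then ?S else 0))"
    have "(\<Sum>j\<in>UNIV. k j * vertical_part j ?x) = ?S"
      by (simp add: k_def left_diff_distrib sum_subtractf if_distrib[of "\<lambda>x. x * _"] cong: if_cong)
    moreover have "(\<Sum>j\<in>UNIV. k j * coord_vec A c j p f) =
        (\<Sum>j\<in>UNIV. v (coord c j) * coord_vec A c j p f) - ?S * coord_vec A c it p f" for f
      by (simp add: k_def left_diff_distrib sum_subtractf if_distrib[of "\<lambda>x. x * _"] cong: if_cong)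
    ultimately have "v = (\<lambda>f. \<Sum>j\<in>UNIV. k j * darboux_frame A c j p f)"
      using tangent_expand[OF A c p v] by (simp add: comb)
    then show "v \<in> {(\<lambda>f. \<Sum>j\<in>UNIV. k j * darboux_frame A c j p f) | k. True}" by blast
  next
    fix v assume "v \<in> {(\<lambda>f. \<Sum>j\<in>UNIV. k j * darboux_frame A c j p f) | k. True}"
    then obtain k where v: "v = (\<lambda>f. \<Sum>j\<in>UNIV. k j * darboux_frame A c j p f)" by blast
    define k' where
      "k' = (\<lambda>j. k j + (if j = it then \<Sum>j\<in>UNIV. k j * vertical_part j ?x else 0))"
    have "v = (\<lambda>f. \<Sum>j\<in>UNIV. k' j * coord_vec A c j p f)"
      by (simp add: v comb k'_def distrib_right sum.distrib if_distrib[of "\<lambda>x. x * _"] cong: if_cong)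
    then show "v \<in> tangent_space A p" using tangentI[OF A c p] by simp
  next
    fix k j assume 0: "(\<lambda>f. \<Sum>j\<in>UNIV. k j * darboux_frame A c j p f) = (\<lambda>f. 0)"
    have E: "k j + (if j = it then \<Sum>i\<in>UNIV. k i * vertical_part i ?x else 0) = 0" for j
      using fun_cong[OF 0, of "coord c j"]
      by (cases "j = it") (simp_all add: darboux_frame_coord[OF p] heisenberg_field_nth distrib_left sum.distrib
          if_distrib[of "\<lambda>x. _ * x"] cong: if_cong)
    \<comment> \<open>For \<open>i\<close> other than \<open>it\<close>, \<open>E\<close> gives
      \<open>k i = 0\<close>; at \<open>it\<close> the vertical part is zero. The correction in
      \<open>E\<close> therefore disappears.\<close>
    have "k i * vertical_part i ?x = 0" for i
      using E[of i] by (cases i rule: cindex_cases) simp_all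
    then have "(\<Sum>i\<in>UNIV. k i * vertical_part i ?x) = 0"
      by (intro sum.neutral ballI)
    then show "k j = 0" using E[of j] by (simp split: if_splits)
  qed
qed

text \<open>A linear form differentiated along a field is the form applied to its components; the
  point-dependent component points along t, which the form ignores. Hence the value is independent
  of \<open>p\<close>.\<close>

lemma darboux_frame_vertical_part:
  assumes p: "p \<in> cdom c"
  shows "darboux_frame A c i p (\<lambda>q. vertical_part j (cmap c q)) = vertical_part j (axis i 1)"
proof -
  note T = darboux_frame_tangent[OF p, of i]
  have E: "darboux_frame A c i p (\<lambda>q. k * coord c l q) = k * heisenberg_field i (cmap c p) $ l" for k l
    by (simp add: tangent_mult[OF A T smooth_near_const[OF A] smooth_near_coord[OF A c p]]
        tangent_const[OF A T] darboux_frame_coord[OF p])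
  have "darboux_frame A c i p (\<lambda>q. vertical_part j (cmap c q))
      = vertical_part j (heisenberg_field i (cmap c p))"
    using E[of "-1/2"] E[of "1/2"] by (cases j rule: cindex_cases)
      (simp_all add: coord_def tangent_const[OF A T])
  then show ?thesis by (simp add: vertical_part_heisenberg_field)
qed

lemma darboux_frame_second:
  assumes p: "p \<in> cdom c"
  shows "darboux_frame A c i p (\<lambda>q. darboux_frame A c j q (coord c k)) =
    (if k = it then vertical_part j (axis i 1) else 0)"
proof -
  note T = darboux_frame_tangent[OF p, of i]
  have "darboux_frame A c i p (\<lambda>q. darboux_frame A c j q (coord c k)) =
      darboux_frame A c i p (\<lambda>q. (if k = j then 1 else 0)
        + (if k = it then vertical_part j (cmap c q) else 0))"
    by (rule tangent_cong[OF A T open_cdom[OF A c] p])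
      (simp add: darboux_frame_coord heisenberg_field_nth)
  also have "\<dots> = (if k = it then vertical_part j (axis i 1) else 0)"
    using smooth_fun_near[OF open_cdom[OF A c] p smooth_fun_vertical_part]
    by (auto simp: tangent_const[OF A T] tangent_add[OF A T smooth_near_const[OF A]]
        darboux_frame_vertical_part[OF p])
  finally show ?thesis .
qed

lemma structure_functions_darboux:
  "structure_functions A contact_weight (cdom c) (darboux_frame A c) (\<lambda>i j k p. heisenberg_const i j k)"
  unfolding structure_functions_def
proof (intro conjI allI ballI)
  show "smooth_fun A (cdom c) (\<lambda>p. heisenberg_const i j k)" for i j k by (rule smooth_fun_const)
  fix i j :: "'m cindex" and p assume p: "p \<in> cdom c"
  \<comment> \<open>This places \<open>it\<close> in the restricted index set of the last sum, so
    the restriction loses no term.\<close>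
  have it: "contact_weight it \<le> contact_weight i + contact_weight j"
    using contact_weight_ge[of i] contact_weight_ge[of j] by simp
  have "lie_bracket A (darboux_frame A c i) (darboux_frame A c j) p =
      (\<lambda>f. \<Sum>k\<in>UNIV. heisenberg_const i j k * coord_vec A c k p f)"
    unfolding lie_bracket_expand[OF A c open_cdom[OF A c] smooth_vfield_darboux_frame
        smooth_vfield_darboux_frame p p] darboux_frame_second[OF p]
    by (intro ext sum.cong refl) (simp add: heisenberg_const_def)
  also have "\<dots> = (\<lambda>f. heisenberg_const i j it * coord_vec A c it p f)"
    by (simp add: heisenberg_const_def if_distrib[of "\<lambda>x. x * _"] cong: if_cong)
  also have "\<dots> = (\<lambda>f. \<Sum>k | contact_weight k \<le> contact_weight i + contact_weight j.
        heisenberg_const i j k * darboux_frame A c k p f)"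
    using it by (simp add: heisenberg_const_def if_distrib[of "\<lambda>x. x * _"] cong: if_cong)
  finally show "lie_bracket A (darboux_frame A c i) (darboux_frame A c j) p =
      (\<lambda>f. \<Sum>k | contact_weight k \<le> contact_weight i + contact_weight j.
        heisenberg_const i j k * darboux_frame A c k p f)" .
qed

context
  fixes a :: 'a
  assumes a: "a \<in> cdom c" "cmap c a = 0"
begin

text \<open>For all small nonzero \<open>s\<close> the rescaled field already equals the homogeneous
  field on the ball; \<open>s = 0\<close>, where homogeneity fails, is excluded by the filter
  \<open>at 0\<close>.\<close>

lemma is_model_vfield_darboux:
  "is_model_vfield contact_weight (darboux_frame A c) c j (heisenberg_field j)"
  unfolding is_model_vfield_def
proof (rule smooth_limit_eventually_eq[OF smooth_heisenberg_field])
  fix r :: real assume "r > 0"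
  let ?S = "cmap c ` cdom c"
  have "open ?S" using is_chart[OF A c] by (simp add: is_chart_def)
  moreover have "0 \<in> ?S" using a by force
  ultimately have "\<forall>\<^sub>F s in at 0. \<forall>x\<in>ball 0 r. dilation contact_weight s x \<in> ?S"
    using \<open>r > 0\<close> by (intro eventually_dilation_in contact_weight_ge)
  moreover have "\<forall>\<^sub>F s in at (0::real). s \<noteq> 0" by (simp add: eventually_at_filter)
  ultimately show "\<forall>\<^sub>F s in at 0. \<forall>x\<in>ball 0 r. s ^ contact_weight j *\<^sub>R
      dilation_pullback contact_weight s (chart_rep c (darboux_frame A c j)) x = heisenberg_field j x"
  proof eventually_elim
    case (elim s)
    have "chart_rep c (darboux_frame A c j) y = heisenberg_field j y" if "y \<in> ?S" for y
      using that by (auto simp: chart_rep_def vec_eq_iff darboux_frame_coord cinv_cmap[OF A c])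
    then show ?case
      using elim heisenberg_field_dilation[of s j] by (auto simp: dilation_pullback_def)
  qed
qed

text \<open>A word of weight below 2 has at most one letter. The empty word gives the coordinate of
  the centre, 0; a single letter \<open>i\<close> gives the (i,j) entry of the identity matrix, as
  vertical parts vanish at 0. The word \<open>[j]\<close> attains the order.\<close>

lemma has_order_coord:
  "has_order A contact_weight (darboux_frame A c) a (coord c j) (contact_weight j)"
  unfolding has_order_def
proof (intro conjI allI impI)
  show "smooth_near A a (coord c j)" by (rule smooth_near_coord[OF A c a(1)])
  have v0: "vertical_part i (0 :: real ^ ('m cindex)) = 0" for i
    by (rule linear_0[OF linear_vertical_part])
  show "\<exists>I. sum_list (map contact_weight I) = contact_weight j \<and>
      iter_vfield (darboux_frame A c) I (coord c j) a \<noteq> 0"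
    by (rule exI[of _ "[j]"]) (simp add: darboux_frame_coord a heisenberg_field_nth v0)
  fix I :: "'m cindex list" assume I: "sum_list (map contact_weight I) < contact_weight j"
  show "iter_vfield (darboux_frame A c) I (coord c j) a = 0"
  proof (cases I)
    case Nil
    then show ?thesis by (simp add: coord_def a)
  next
    case (Cons i I')
    have "I' = []"
    proof (rule ccontr)
      assume "I' \<noteq> []"
      then obtain i' I'' where "I' = i' # I''" by (cases I') auto
      then show False
        using I Cons contact_weight_ge[of i] contact_weight_ge[of i'] contact_weight_le[of j] by simp
    qed
    moreover have "i \<noteq> j" using I Cons by auto
    ultimately show ?thesis
      using Cons by (simp add: darboux_frame_coord a heisenberg_field_nth v0)
  qed
qed

lemma carnot_coords2_darboux: "carnot_coords2 A contact_weight (darboux_frame A c) a c"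
proof -
  have v0: "vertical_part i (0 :: real ^ ('m cindex)) = 0" for i
    by (rule linear_0[OF linear_vertical_part])
  have "privileged_coords A contact_weight (darboux_frame A c) a c"
    using has_order_coord c a
    by (simp add: privileged_coords_def linearly_adapted_def darboux_frame_eq v0)
  moreover have "heisenberg_field j 0 = axis j 1" for j :: "'m cindex"
    by (simp add: heisenberg_field_def v0)
  ultimately show ?thesis
    unfolding carnot_coords2_def
    using open_cdom[OF A c] a(1) structure_functions_darboux left_invariant_heisenberg_field
      is_model_vfield_darboux
    by blast
qed

end

end

section \<open>The contact filtration\<close>

lemma contact_manifold_tangent:
  assumes "contact_manifold A H"
  shows "H p \<subseteq> tangent_space A p"
proof -
  obtain U \<theta> where "p \<in> U" "\<forall>q\<in>U. H q = form_ker A \<theta> q"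
    using assms unfolding contact_manifold_def by meson
  then show ?thesis by (auto simp: form_ker_def)
qed

lemma carnot_manifold_contact:
  fixes A :: "('a::{t2_space,second_countable_topology}, 'm::finite cindex) chart set"
  assumes "contact_manifold A H"
  shows "carnot_manifold A 2 (contact_filtration A H) contact_weight"
proof -
  have A: "smooth_structure A" and H: "subbundle A H (2 * CARD('m))"
    using assms by (simp_all add: contact_manifold_def)
  have "{j :: 'm cindex. contact_weight j \<le> 1} = range Inl"
  proof (intro set_eqI iffI)
    show "j \<in> range Inl" if "j \<in> {j :: 'm cindex. contact_weight j \<le> 1}" for j
      using that by (cases j) auto
  qed auto
  then have c1: "card {j :: 'm cindex. contact_weight j \<le> 1} = 2 * CARD('m)"
    by (simp add: card_image card_UNIV_sum)
  have c2: "{j :: 'm cindex. contact_weight j \<le> 2} = UNIV"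
    using contact_weight_le by auto
  have sub: "subbundle A (contact_filtration A H v) (card {j :: 'm cindex. contact_weight j \<le> v})"
    if "v \<in> {1..2}" for v
  proof -
    have "v = 1 \<or> v = 2" using that by auto
    then show ?thesis
      using H subbundle_tangent_space[OF A] c1 c2 by (auto simp: contact_filtration_def)
  qed
  \<comment> \<open>Since \<open>v + v' \<ge> 2\<close>, the target is the full tangent bundle, so
    closure of smooth fields under the bracket is enough.\<close>
  have bracket: "is_section A (contact_filtration A H (v + v')) U (lie_bracket A X Y)"
    if "1 \<le> v" "1 \<le> v'" "open U"
      "is_section A (contact_filtration A H v) U X" "is_section A (contact_filtration A H v') U Y"
    for v v' U X Y
    using that smooth_vfield_lie_bracket[OF A that(3), of X Y]
    by (auto simp: is_section_def contact_filtration_def smooth_vfield_tangent)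
  show ?thesis
    unfolding carnot_manifold_def
    using A sub bracket contact_weight_ge contact_weight_le contact_manifold_tangent[OF assms]
    by (auto simp: contact_filtration_def)
qed

text \<open>Here the Darboux form of the contact form enters: the t-component of the field
  contributes half a coordinate, and the sum contributes its negative.\<close>

lemma darboux_frame_in_kernel:
  assumes A: "smooth_structure A" and D: "darboux_coords A U \<theta> a c" and p: "p \<in> cdom c"
    and j: "j \<noteq> it"
  shows "darboux_frame A c j p \<in> form_ker A \<theta> p"
proof -
  have c: "c \<in> A" using D by (simp add: darboux_coords_def)
  have T: "darboux_frame A c j p \<in> tangent_space A p" by (rule darboux_frame_tangent[OF A c p])
  then have "\<theta> p (darboux_frame A c j p) =
      heisenberg_field j (cmap c p) $ it + 1/2 * (\<Sum>l\<in>UNIV.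
        coord c (iy l) p * heisenberg_field j (cmap c p) $ ix l
        - coord c (ix l) p * heisenberg_field j (cmap c p) $ iy l)"
    using D p by (simp add: darboux_coords_def darboux_frame_coord[OF A c p])
  also have "\<dots> = 0"
    using j by (cases j rule: cindex_cases)
      (simp_all add: heisenberg_field_nth coord_def sum_negf if_distrib[of "\<lambda>x. _ * x"] cong: if_cong)
  finally show ?thesis using T by (simp add: form_ker_def)
qed

lemma H_frame_near_darboux:
  assumes A: "smooth_structure A" and D: "darboux_coords A U \<theta> a c"
    and H: "\<forall>p\<in>U. form_ker A \<theta> p = H p"
  shows "H_frame_near A (contact_filtration A H) contact_weight a (darboux_frame A c)"
  unfolding H_frame_near_def
proof (intro exI[of _ "cdom c"] conjI allI ballI)
  have c: "c \<in> A" and "cdom c \<subseteq> U" using D by (simp_all add: darboux_coords_def)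
  show "open (cdom c)" by (rule open_cdom[OF A c])
  show "a \<in> cdom c" using D by (simp add: darboux_coords_def)
  show "is_basis UNIV (\<lambda>j. darboux_frame A c j p) (tangent_space A p)" if "p \<in> cdom c" for p
    by (rule darboux_frame_basis[OF A c that])
  fix j
  have "darboux_frame A c j p \<in> contact_filtration A H (contact_weight j) p" if "p \<in> cdom c" for p
    using darboux_frame_tangent[OF A c that, of j] darboux_frame_in_kernel[OF A D that, of j]
      H \<open>cdom c \<subseteq> U\<close> that
    by (auto simp only: contact_filtration_def contact_weight_le_1_iff split: if_splits)
  then show "is_section A (contact_filtration A H (contact_weight j)) (cdom c) (darboux_frame A c j)"
    using smooth_vfield_darboux_frame[OF A c] by (simp add: is_section_def)
qed

theorem proposition5p12:
  fixes A :: "('a::{t2_space,second_countable_topology}, 'm::finite cindex) chart set"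
    and H :: "'a \<Rightarrow> 'a tvec set"
    and \<theta> :: "'a \<Rightarrow> 'a tvec \<Rightarrow> real"
    and U :: "'a set" and a :: 'a
    and c :: "('a, 'm cindex) chart"
  assumes "contact_manifold A H"
    and "open U" and "a \<in> U"
    and "contact_form A U \<theta>" and "\<forall>p\<in>U. form_ker A \<theta> p = H p"
    and "darboux_coords A U \<theta> a c"
  shows "carnot_manifold A 2 (contact_filtration A H) contact_weight \<and>
    H_frame_near A (contact_filtration A H) contact_weight a (darboux_frame A c) \<and>
    carnot_coords2 A contact_weight (darboux_frame A c) a c"
proof -
  have A: "smooth_structure A" using assms(1) by (simp add: contact_manifold_def)
  have "c \<in> A" "a \<in> cdom c" "cmap c a = 0" using assms(6) by (simp_all add: darboux_coords_def)
  then show ?thesis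
    using carnot_manifold_contact[OF assms(1)] H_frame_near_darboux[OF A assms(6,5)]
      carnot_coords2_darboux[OF A] by simp
qed

end
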